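(* Let $m\ge1$, $1\leq p<2$, $0\le\alpha\le1$, $\nu\in\{0,1,2,\dots\}$, and let $\varphi\in C^{\nu,\alpha}(\mathbb T^m)$ be a real function. Suppose $\nu+\alpha\geq1$ and $\nu+\alpha>m(1/p-1/2)$. Then $$\|e^{i\lambda\varphi}\|_{A_p(\mathbb T^m)}=O\big(|\lambda|^{m(1/p-1/2)}\big),\qquad |\lambda|\to\infty,\ \lambda\in\mathbb R.$$
   Context: $\mathbb T^m=\mathbb R^m/2\pi\mathbb Z^m$; functions on $\mathbb T^m$ are identified with $2\pi$-periodic functions on $\mathbb R^m$. $\widehat f(k)=(2\pi)^{-m}\int_{\mathbb T^m}f(t)e^{-i(k,t)}dt$; $A_1(\mathbb T^m)$ is the space of continuous $f$ with $\widehat f\in l^1(\mathbb Z^m)$, for $1<p\le2$ $A_p(\mathbb T^m)$ is the space of integrable $f$ with $\widehat f\in l^p$; $\|f\|_{A_p(\mathbb T^m)}=\|\widehat f\|_{l^p(\mathbb Z^m)}$. For $0<\alpha\le1$, $C^{\nu,\alpha}(\mathbb T^m)$ is the class of $\nu$ times differentiable functions on $\mathbb T^m$ all of whose partial derivatives of order $\nu$ (for $\nu=0$, the function itself) satisfy a Lipschitz condition of order $\alpha$; $C^{\nu,0}(\mathbb T^m)=C^\nu(\mathbb T^m)$, the class of functions whose partial derivatives of order $\nu$ are continuous. *)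

theory Defs
  imports "HOL-Analysis.Analysis"
begin

text \<open>Functions on the torus T^m are 2pi-periodic functions on R^m, modelled as
  functions on real^'m with m = CARD('m).\<close>

definition torus_periodic :: "(real^'m \<Rightarrow> 'b) \<Rightarrow> bool" where
  "torus_periodic f \<longleftrightarrow> (\<forall>x j. f (x + (2*pi) *\<^sub>R axis j 1) = f x)"

fun iter_pd :: "'m list \<Rightarrow> (real^'m \<Rightarrow> real) \<Rightarrow> real^'m \<Rightarrow> real" where
  "iter_pd [] f = f"
| "iter_pd (j # js) f = (\<lambda>x. deriv (\<lambda>h. iter_pd js f (x + h *\<^sub>R axis j 1)) 0)"

definition C_nu_alpha :: "nat \<Rightarrow> real \<Rightarrow> (real^'m \<Rightarrow> real) \<Rightarrow> bool" where
  "C_nu_alpha \<nu> \<alpha> f \<longleftrightarrow>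
     torus_periodic f \<and>
     (\<forall>js x j. length js < \<nu> \<longrightarrow>
        (\<lambda>h. iter_pd js f (x + h *\<^sub>R axis j 1)) differentiable (at 0)) \<and>
     (\<forall>js. length js = \<nu> \<longrightarrow>
        (if \<alpha> = 0 then continuous_on UNIV (iter_pd js f)
         else (\<exists>C. \<forall>x y. \<bar>iter_pd js f x - iter_pd js f y\<bar> \<le> C * norm (x - y) powr \<alpha>)))"

definition fourier_coeff :: "(real^'m \<Rightarrow> complex) \<Rightarrow> int^'m \<Rightarrow> complex" where
  "fourier_coeff f k =
     complex_of_real ((2*pi) powr (- real CARD('m))) *
     integral (cbox 0 (\<chi> i. 2*pi))
       (\<lambda>t. f t * exp (- \<i> * complex_of_real (\<Sum>i\<in>UNIV. of_int (k$i) * t$i)))"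

definition in_Ap :: "real \<Rightarrow> (real^'m \<Rightarrow> complex) \<Rightarrow> bool" where
  "in_Ap p f \<longleftrightarrow> (\<lambda>k. norm (fourier_coeff f k) powr p) summable_on UNIV"

definition Ap_norm :: "real \<Rightarrow> (real^'m \<Rightarrow> complex) \<Rightarrow> real" where
  "Ap_norm p f = (\<Sum>\<^sub>\<infinity>k. norm (fourier_coeff f k) powr p) powr (1/p)"

end

theory Submission
  imports Defs
begin

text \<open>
  Write \<open>s = \<nu> + \<alpha>\<close> and \<open>f = exp (i lam \<phi>)\<close>. Along a coordinate line, \<open>t \<mapsto> lam \<phi> (x + (t / |lam|) e\<^sub>j)\<close> has
  derivatives bounded uniformly in \<open>x\<close> and \<open>|lam| \<ge> 1\<close>, so the difference of order \<open>\<nu> + 1\<close> of \<open>f\<close> with step \<open>h\<close>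
  is \<open>O((|lam| h) powr s)\<close>. This difference multiplies the \<open>k\<close>-th Fourier coefficient by \<open>(exp (i k\<^sub>j h) - 1) ^ (\<nu> + 1)\<close>,
  so Bessel's inequality with \<open>h = pi / N\<close> bounds the \<open>l\<^sup>2\<close>-norm of the coefficients with \<open>N / 2 < |k|\<^sub>\<infinity> \<le> N\<close>
  by \<open>O((|lam| / N) powr s)\<close>. Passing from \<open>l\<^sup>2\<close> to \<open>l\<^sup>p\<close> on each block \<open>N = 2 ^ i |lam|\<close> costs a power
  of the number \<open>O(N ^ m)\<close> of its points, and the hypothesis on \<open>s\<close> makes the sum over the blocks geometric.
\<close>

subsection \<open>Fourier coefficients on the torus\<close>

text \<open>The box lengthened by \<open>h\<close> in direction \<open>j\<close> is cut once at 2 pi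
  and once at \<open>h\<close>. By periodicity the piece beyond 2 pi has the same integral as the
  piece before \<open>h\<close>; cancelling these two leaves the claim.\<close>

lemma torus_integral_shift:
  fixes f :: "real^'m \<Rightarrow> complex"
  assumes c: "continuous_on UNIV f" and per: "torus_periodic f" and h: "0 \<le> h" "h \<le> 2*pi"
  shows "integral (cbox 0 (\<chi> i. 2*pi)) (\<lambda>t. f (t + h *\<^sub>R axis j 1)) = integral (cbox 0 (\<chi> i. 2*pi)) f"
proof -
  define e :: "real^'m" where "e = axis j 1"
  define b :: "real^'m" where "b = (\<chi> i. 2*pi)"
  have eB: "e \<in> Basis" by (simp add: e_def axis_in_Basis_iff)
  have ie: "x \<bullet> e = x $ j" for x by (simp add: e_def inner_axis)
  have ec: "e $ i = (if i = j then 1 else 0)" for i by (simp add: e_def axis_def)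
  have int: "f integrable_on cbox u v" for u v
    by (rule integrable_continuous) (rule continuous_on_subset[OF c], simp)
  have s: "integral (cbox 0 (b + h *\<^sub>R e)) f =
     integral (cbox 0 (b + h *\<^sub>R e) \<inter> {x. x\<bullet>e \<le> r}) f + integral (cbox 0 (b + h *\<^sub>R e) \<inter> {x. x\<bullet>e \<ge> r}) f" for r
    by (rule integral_split[OF int eB])
  have mb: "y \<in> cbox u v \<longleftrightarrow> (u $ j \<le> y $ j \<and> y $ j \<le> v $ j) \<and> (\<forall>i. i \<noteq> j \<longrightarrow> u $ i \<le> y $ i \<and> y $ i \<le> v $ i)"
    for u v y :: "real^'m"
    by (auto simp: mem_box_cart)
  have s1: "cbox 0 (b + h *\<^sub>R e) \<inter> {x. x\<bullet>e \<le> 2*pi} = cbox 0 b"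
    using h unfolding ie by (auto simp: mb b_def ec)
  have s2: "cbox 0 (b + h *\<^sub>R e) \<inter> {x. x\<bullet>e \<ge> 2*pi} = cbox (0 + (2*pi) *\<^sub>R e) ((b - (2*pi - h) *\<^sub>R e) + (2*pi) *\<^sub>R e)"
    using h unfolding ie by (auto simp: mb b_def ec)
  have s3: "cbox 0 (b + h *\<^sub>R e) \<inter> {x. x\<bullet>e \<le> h} = cbox 0 (b - (2*pi - h) *\<^sub>R e)"
    using h unfolding ie by (auto simp: mb b_def ec)
  have s4: "cbox 0 (b + h *\<^sub>R e) \<inter> {x. x\<bullet>e \<ge> h} = cbox (0 + h *\<^sub>R e) (b + h *\<^sub>R e)"
    using h unfolding ie by (auto simp: mb b_def ec)
  have sh: "integral (cbox (u + c) (v + c)) f = integral (cbox u v) (\<lambda>t. f (t + c))" for u v c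
    using integral_shift_cbox[of "u + c" c "v + c" f] by simp
  have per': "f (x + (2*pi) *\<^sub>R e) = f x" for x
    using per by (simp add: torus_periodic_def e_def)
  have "integral (cbox 0 b) f + integral (cbox 0 (b - (2*pi - h) *\<^sub>R e)) f
      = integral (cbox 0 (b - (2*pi - h) *\<^sub>R e)) f + integral (cbox 0 b) (\<lambda>t. f (t + h *\<^sub>R e))"
    using s[of "2*pi"] s[of h] unfolding s1 s2 s3 s4
    unfolding sh by (simp add: per')
  thus ?thesis by (simp add: b_def e_def)
qed

lemma torus_periodic_mult:
  assumes "torus_periodic f" "torus_periodic g"
  shows "torus_periodic (\<lambda>t. f t * g t)"
  using assms by (simp add: torus_periodic_def)

lemma torus_periodic_shift:
  assumes "torus_periodic f"
  shows "torus_periodic (\<lambda>t. f (t + v))"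
proof -
  have "f (x + (2*pi) *\<^sub>R axis j 1 + v) = f (x + v)" for x j
    using assms[unfolded torus_periodic_def, rule_format, of "x + v" j] by (simp add: add_ac)
  thus ?thesis by (simp add: torus_periodic_def)
qed

section \<open>Characters, orthogonality and Bessel's inequality\<close>

definition torus_char :: "int^'m \<Rightarrow> real^'m \<Rightarrow> complex" where
  "torus_char k t = exp (- \<i> * complex_of_real (\<Sum>i\<in>UNIV. of_int (k$i) * t$i))"

lemma fourier_coeff_torus_char:
  "fourier_coeff (f :: real^'m \<Rightarrow> complex) k = complex_of_real ((2*pi) powr (- real CARD('m))) *
     integral (cbox 0 (\<chi> i. 2*pi)) (\<lambda>t. f t * torus_char k t)"
  by (simp add: fourier_coeff_def torus_char_def)

lemma continuous_on_torus_char [continuous_intros]: "continuous_on A (torus_char k)"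
  unfolding torus_char_def by (intro continuous_intros)

lemma torus_char_shift:
  "torus_char k (t + h *\<^sub>R axis j 1) = exp (- \<i> * complex_of_real (of_int (k$j) * h)) * torus_char k t"
proof -
  have "(\<Sum>i\<in>UNIV. real_of_int (k$i) * (t + h *\<^sub>R axis j 1)$i)
      = (\<Sum>i\<in>UNIV. of_int (k$i) * t$i) + (\<Sum>i\<in>UNIV. if i = j then of_int (k$i) * h else 0)"
    unfolding sum.distrib[symmetric] by (intro sum.cong) (auto simp: axis_def algebra_simps)
  hence "(\<Sum>i\<in>UNIV. real_of_int (k$i) * (t + h *\<^sub>R axis j 1)$i)
      = of_int (k$j) * h + (\<Sum>i\<in>UNIV. of_int (k$i) * t$i)" by simp
  thus ?thesis
    unfolding torus_char_def exp_add[symmetric] by (simp only: of_real_add ring_distribs)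
qed

lemma torus_periodic_torus_char: "torus_periodic (torus_char k)"
proof -
  have "exp (- \<i> * complex_of_real (of_int n * (2*pi))) = 1" for n
    by (simp add: exp_eq_1 exI[of _ "- n"])
  thus ?thesis unfolding torus_periodic_def torus_char_shift by simp
qed

lemma cnj_torus_char: "cnj (torus_char k t) = torus_char (- k) t"
  by (simp add: torus_char_def exp_cnj sum_negf)

lemma torus_char_mult: "torus_char k t * torus_char l t = torus_char (k + l) t"
  by (simp add: torus_char_def mult_exp_exp ring_distribs sum.distrib)

lemma torus_char_0 [simp]: "torus_char 0 t = 1"
  by (simp add: torus_char_def)

lemma content_torus_cbox: "measure lborel (cbox 0 (\<chi> i. 2*pi) :: (real^'m) set) = (2*pi) ^ CARD('m)"
proof -
  have "0 \<in> (cbox 0 (\<chi> i. 2*pi) :: (real^'m) set)" by (simp add: mem_box_cart)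
  hence "cbox 0 (\<chi> i. 2*pi) \<noteq> ({} :: (real^'m) set)" by blast
  thus ?thesis by (simp add: content_cbox_cart)
qed

text \<open>If \<open>k $ j\<close> is nonzero, a shift by pi / |\<open>k $ j\<close>| along axis
  \<open>j\<close> multiplies the character by -1 but preserves its integral, which therefore equals
  its own negative.\<close>

lemma integral_torus_char:
  fixes k :: "int^'m"
  shows "integral (cbox 0 (\<chi> i. 2*pi)) (torus_char k) = (if k = 0 then (2*pi) ^ CARD('m) else 0)"
proof (cases "k = 0")
  case True
  have "torus_char k = (\<lambda>_. 1)" using True by auto
  thus ?thesis using True content_torus_cbox[where 'm='m] by (simp add: of_real_def)
next
  case False
  then obtain j where j: "k $ j \<noteq> 0" by (auto simp: vec_eq_iff)
  define h where "h = pi / \<bar>real_of_int (k $ j)\<bar>"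
  have k1: "1 \<le> \<bar>real_of_int (k $ j)\<bar>" using j by linarith
  have "h \<le> pi / 1" unfolding h_def using k1 by (intro divide_left_mono) auto
  hence h: "0 \<le> h" "h \<le> 2 * pi" using pi_gt_zero by (simp add: h_def, linarith)
  have kh: "real_of_int (k $ j) * h = pi \<or> real_of_int (k $ j) * h = - pi"
    using j by (auto simp: h_def abs_if)
  have "exp (- \<i> * complex_of_real (of_int (k$j) * h)) = -1"
  proof -
    have "exp (- \<i> * complex_of_real pi) = -1" by (simp add: exp_minus)
    moreover have "exp (- \<i> * complex_of_real (- pi)) = -1" by simp
    ultimately show ?thesis using kh by metis
  qed
  hence "integral (cbox 0 (\<chi> i. 2*pi)) (\<lambda>t. torus_char k (t + h *\<^sub>R axis j 1))
      = - integral (cbox 0 (\<chi> i. 2*pi)) (torus_char k)"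
    unfolding torus_char_shift by simp
  moreover have "integral (cbox 0 (\<chi> i. 2*pi)) (\<lambda>t. torus_char k (t + h *\<^sub>R axis j 1))
      = integral (cbox 0 (\<chi> i. 2*pi)) (torus_char k)"
    by (rule torus_integral_shift[OF _ torus_periodic_torus_char h]) (intro continuous_intros)
  ultimately show ?thesis using False by simp
qed

text \<open>Translation invariance of the integral moves the shift from \<open>f\<close> onto the
  character, where it is only a constant phase.\<close>

lemma fourier_coeff_difference:
  fixes f :: "real^'m \<Rightarrow> complex"
  assumes c: "continuous_on UNIV f" and per: "torus_periodic f" and h: "0 \<le> h" "h \<le> 2*pi"
  shows "fourier_coeff (\<lambda>t. f (t + h *\<^sub>R axis j 1) - f t) k =
    (exp (\<i> * complex_of_real (of_int (k$j) * h)) - 1) * fourier_coeff f k"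
proof -
  define B :: "(real^'m) set" where "B = cbox 0 (\<chi> i. 2*pi)"
  define z where "z = exp (\<i> * complex_of_real (of_int (k$j) * h))"
  have int: "g integrable_on (B :: (real^'m) set)" if "continuous_on UNIV g" for g :: "real^'m \<Rightarrow> complex"
    unfolding B_def by (rule integrable_continuous) (rule continuous_on_subset[OF that], simp)
  have z: "z * exp (- \<i> * complex_of_real (of_int (k$j) * h)) = 1"
    by (simp add: z_def mult_exp_exp)
  have c': "continuous_on UNIV (\<lambda>t. f (t + h *\<^sub>R axis j 1))"
    by (rule continuous_on_compose2[OF c]) (auto intro!: continuous_intros)
  \<comment> \<open>The factor \<open>z\<close> undoes the phase picked up by the character, so that
    the whole integrand appears shifted.\<close>
  have "integral B (\<lambda>t. f (t + h *\<^sub>R axis j 1) * torus_char k t)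
    = integral B (\<lambda>t. z * (f (t + h *\<^sub>R axis j 1) * torus_char k (t + h *\<^sub>R axis j 1)))"
  proof (intro arg_cong[where f = "integral B"] ext)
    show "f (t + h *\<^sub>R axis j 1) * torus_char k t
      = z * (f (t + h *\<^sub>R axis j 1) * torus_char k (t + h *\<^sub>R axis j 1))" for t
    proof -
      have "z * (f (t + h *\<^sub>R axis j 1) * (exp (- \<i> * complex_of_real (of_int (k$j) * h)) * torus_char k t))
        = (z * exp (- \<i> * complex_of_real (of_int (k$j) * h))) * (f (t + h *\<^sub>R axis j 1) * torus_char k t)"
        by (simp only: mult_ac)
      thus ?thesis unfolding torus_char_shift z by simp
    qed
  qed
  also have "\<dots> = z * integral B (\<lambda>t. f (t + h *\<^sub>R axis j 1) * torus_char k (t + h *\<^sub>R axis j 1))"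
    by simp
  also have "integral B (\<lambda>t. f (t + h *\<^sub>R axis j 1) * torus_char k (t + h *\<^sub>R axis j 1))
    = integral B (\<lambda>t. f t * torus_char k t)"
    unfolding B_def
    by (rule torus_integral_shift[of "\<lambda>t. f t * torus_char k t"])
       (auto intro!: continuous_intros c torus_periodic_mult per torus_periodic_torus_char h)
  finally have "integral B (\<lambda>t. f (t + h *\<^sub>R axis j 1) * torus_char k t) = z * integral B (\<lambda>t. f t * torus_char k t)" .
  moreover have "integral B (\<lambda>t. (f (t + h *\<^sub>R axis j 1) - f t) * torus_char k t)
     = integral B (\<lambda>t. f (t + h *\<^sub>R axis j 1) * torus_char k t) - integral B (\<lambda>t. f t * torus_char k t)"
    unfolding left_diff_distrib
    by (intro Henstock_Kurzweil_Integration.integral_diff int continuous_intros c c')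
  ultimately show ?thesis
    unfolding fourier_coeff_torus_char B_def[symmetric] z_def[symmetric] by (simp only: left_diff_distrib mult_ac mult_1_left right_diff_distrib)
qed

text \<open>Expand the integral of |f - T|^2, where \<open>T\<close> is the partial Fourier sum over
  \<open>F\<close>. By orthogonality each term containing \<open>T\<close> equals V * S up to sign,
  so V * S is at most the integral of |f|^2, hence at most V * B^2.\<close>

lemma bessel_fourier_coeff:
  fixes f :: "real^'m \<Rightarrow> complex"
  assumes c: "continuous_on UNIV f" and bd: "\<And>t. norm (f t) \<le> B" and F: "finite F"
  shows "(\<Sum>k\<in>F. (norm (fourier_coeff f k))\<^sup>2) \<le> B\<^sup>2"
proof -
  define I :: "(real^'m \<Rightarrow> complex) \<Rightarrow> complex" where "I = integral (cbox 0 (\<chi> i. 2*pi))"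
  define V :: real where "V = (2*pi) ^ CARD('m)"
  define a where "a = fourier_coeff f"
  \<comment> \<open>The index is \<open>- k\<close> because \<open>torus_char\<close> already
    carries the minus sign of the Fourier coefficient.\<close>
  define T where "T t = (\<Sum>k\<in>F. a k * torus_char (- k) t)" for t
  define S where "S = (\<Sum>k\<in>F. (norm (a k))\<^sup>2)"
  have V: "V > 0" by (simp add: V_def)
  have S: "complex_of_real S = (\<Sum>k\<in>F. a k * cnj (a k))"
    by (simp only: S_def of_real_sum complex_norm_square)
  have int: "g integrable_on cbox 0 (\<chi> i. 2*pi)" if "continuous_on UNIV g" for g :: "real^'m \<Rightarrow> complex"
    by (rule integrable_continuous) (rule continuous_on_subset[OF that], simp)
  have a: "I (\<lambda>t. f t * torus_char k t) = V * a k" for k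
  proof -
    have "(2*pi) powr real CARD('m) = V"
      unfolding V_def by (rule powr_realpow) simp
    hence "V * (2*pi) powr (- real CARD('m)) = 1"
      using V by (simp add: powr_minus)
    hence "complex_of_real V * complex_of_real ((2*pi) powr (- real CARD('m))) = 1"
      by (metis of_real_1 of_real_mult)
    thus ?thesis by (simp only: a_def fourier_coeff_torus_char I_def mult.assoc[symmetric] mult_1_left)
  qed
  have cT: "continuous_on UNIV T" unfolding T_def by (intro continuous_intros)
  have cnjT: "cnj (T t) = (\<Sum>k\<in>F. cnj (a k) * torus_char k t)" for t
    by (simp add: T_def cnj_torus_char)
  have fT: "I (\<lambda>t. f t * cnj (T t)) = V * S"
  proof -
    have "I (\<lambda>t. f t * cnj (T t)) = I (\<lambda>t. \<Sum>k\<in>F. cnj (a k) * (f t * torus_char k t))"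
      unfolding cnjT sum_distrib_left by (simp only: mult_ac)
    also have "\<dots> = (\<Sum>k\<in>F. I (\<lambda>t. cnj (a k) * (f t * torus_char k t)))"
      unfolding I_def by (intro integral_sum F int continuous_intros c)
    also have "\<dots> = (\<Sum>k\<in>F. cnj (a k) * (V * a k))"
      using a by (simp add: I_def)
    also have "\<dots> = V * S"
      unfolding of_real_mult S sum_distrib_left by (simp only: mult_ac)
    finally show ?thesis .
  qed
  have Tf: "I (\<lambda>t. T t * cnj (f t)) = V * S"
  proof -
    have "I (\<lambda>t. T t * cnj (f t)) = I (\<lambda>t. cnj (f t * cnj (T t)))" by (simp add: mult_ac)
    also have "\<dots> = cnj (I (\<lambda>t. f t * cnj (T t)))"
      unfolding I_def using integral_linear[OF int bounded_linear_cnj, of "\<lambda>t. f t * cnj (T t)"]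
      by (simp add: o_def continuous_intros c cT)
    finally show ?thesis by (simp add: fT)
  qed
  have TT: "I (\<lambda>t. T t * cnj (T t)) = V * S"
  proof -
    have "I (\<lambda>t. T t * cnj (T t)) = I (\<lambda>t. \<Sum>k\<in>F. \<Sum>l\<in>F. a k * cnj (a l) * torus_char (l - k) t)"
    proof (intro arg_cong[where f = I] ext)
      fix t
      have "a k * torus_char (- k) t * (cnj (a l) * torus_char l t) = a k * cnj (a l) * torus_char (l - k) t" for k l
        using torus_char_mult[of l t "- k"] by (simp add: mult_ac del: mult_cancel_left)
      thus "T t * cnj (T t) = (\<Sum>k\<in>F. \<Sum>l\<in>F. a k * cnj (a l) * torus_char (l - k) t)"
        unfolding cnjT unfolding T_def sum_product by (simp only:)
    qed
    also have "\<dots> = (\<Sum>k\<in>F. I (\<lambda>t. \<Sum>l\<in>F. a k * cnj (a l) * torus_char (l - k) t))"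
      unfolding I_def by (intro integral_sum F int continuous_intros)
    also have "\<dots> = (\<Sum>k\<in>F. \<Sum>l\<in>F. I (\<lambda>t. a k * cnj (a l) * torus_char (l - k) t))"
      unfolding I_def by (intro sum.cong refl integral_sum F int continuous_intros)
    also have "\<dots> = (\<Sum>k\<in>F. \<Sum>l\<in>F. if l = k then a k * cnj (a l) * V else 0)"
      by (intro sum.cong refl) (simp add: I_def integral_torus_char V_def)
    also have "\<dots> = V * S"
      unfolding of_real_mult S sum_distrib_left using F by (simp add: mult_ac)
    finally show ?thesis .
  qed
  have "I (\<lambda>t. (f t - T t) * cnj (f t - T t))
    = I (\<lambda>t. (f t * cnj (f t) - f t * cnj (T t)) - (T t * cnj (f t) - T t * cnj (T t)))"
    by (simp add: algebra_simps)
  also have "\<dots> = (I (\<lambda>t. f t * cnj (f t)) - I (\<lambda>t. f t * cnj (T t)))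
      - (I (\<lambda>t. T t * cnj (f t)) - I (\<lambda>t. T t * cnj (T t)))"
    unfolding I_def by (simp add: Henstock_Kurzweil_Integration.integral_diff int continuous_intros c cT)
  finally have eq: "I (\<lambda>t. (f t - T t) * cnj (f t - T t)) = I (\<lambda>t. f t * cnj (f t)) - V * S"
    by (simp add: fT Tf TT)
  have Re: "Re (I g) = integral (cbox 0 (\<chi> i. 2*pi)) (\<lambda>t. Re (g t))" if "continuous_on UNIV g" for g
    unfolding I_def using integral_linear[OF int bounded_linear_Re, of g] that by (simp add: o_def)
  have Re_norm: "Re (z * cnj z) = (norm z)\<^sup>2" for z
    by (simp only: complex_norm_square[symmetric] Re_complex_of_real)
  have "0 \<le> Re (I (\<lambda>t. (f t - T t) * cnj (f t - T t)))"
    unfolding Re[OF continuous_on_mult[OF continuous_on_diff[OF c cT] continuous_on_cnj[OF continuous_on_diff[OF c cT]]]] Re_norm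
    by (intro integral_nonneg integrable_continuous continuous_intros continuous_on_subset[OF c] continuous_on_subset[OF cT]) auto
  hence "V * S \<le> Re (I (\<lambda>t. f t * cnj (f t)))" unfolding eq by simp
  also have "\<dots> \<le> integral (cbox 0 (\<chi> i. 2*pi) :: (real^'m) set) (\<lambda>t. B\<^sup>2)"
    unfolding Re[OF continuous_on_mult[OF c continuous_on_cnj[OF c]]] Re_norm
    by (intro integral_le integrable_continuous continuous_intros continuous_on_subset[OF c] power_mono bd) auto
  also have "\<dots> = V * B\<^sup>2"
    by (simp add: content_torus_cbox V_def)
  finally show ?thesis using V by (simp add: S_def a_def)
qed

subsection \<open>Hoelder classes of functions of one variable\<close>

text \<open>One constant \<open>K\<close> controls the function, its derivatives up to order n and
  the Hoelder quotient of the n-th one. Uniformity over a family of functions thus becomes a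
  statement about a single number.\<close>

primrec hoelder_class :: "real \<Rightarrow> nat \<Rightarrow> real \<Rightarrow> (real \<Rightarrow> complex) \<Rightarrow> bool" where
  "hoelder_class \<alpha> 0 K f \<longleftrightarrow> (\<forall>t. norm (f t) \<le> K) \<and> (\<forall>s t. norm (f s - f t) \<le> K * \<bar>s - t\<bar> powr \<alpha>)"
| "hoelder_class \<alpha> (Suc n) K f \<longleftrightarrow> (\<forall>t. norm (f t) \<le> K) \<and>
     (\<exists>f'. (\<forall>t. (f has_vector_derivative f' t) (at t)) \<and> hoelder_class \<alpha> n K f')"

lemma hoelder_class_bound: "hoelder_class \<alpha> n K f \<Longrightarrow> norm (f t) \<le> K"
  by (cases n) auto

lemma hoelder_class_nonneg: "hoelder_class \<alpha> n K f \<Longrightarrow> 0 \<le> K"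
  using hoelder_class_bound[of \<alpha> n K f 0] norm_ge_zero[of "f 0"] by linarith

lemma hoelder_class_SucE:
  assumes "hoelder_class \<alpha> (Suc n) K f"
  obtains f' where "\<And>t. (f has_vector_derivative f' t) (at t)" "hoelder_class \<alpha> n K f'"
  using assms unfolding hoelder_class.simps(2) by blast

lemma hoelder_class_SucI:
  assumes "\<And>t. norm (f t) \<le> K" "\<And>t. (f has_vector_derivative f' t) (at t)" "hoelder_class \<alpha> n K f'"
  shows "hoelder_class \<alpha> (Suc n) K f"
  using assms unfolding hoelder_class.simps(2) by blast

lemma hoelder_class_mono: "hoelder_class \<alpha> n K f \<Longrightarrow> K \<le> L \<Longrightarrow> hoelder_class \<alpha> n L f"
proof (induction n arbitrary: f)
  case 0
  have "norm (f t) \<le> L" for t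
    using 0 by (simp, meson order_trans)
  moreover have "norm (f s - f t) \<le> L * \<bar>s - t\<bar> powr \<alpha>" for s t
  proof -
    have "norm (f s - f t) \<le> K * \<bar>s - t\<bar> powr \<alpha>" using 0 by simp
    also have "\<dots> \<le> L * \<bar>s - t\<bar> powr \<alpha>" using 0 by (intro mult_right_mono) auto
    finally show ?thesis .
  qed
  ultimately show ?case by simp
next
  case (Suc n)
  obtain f' where f': "\<And>t. (f has_vector_derivative f' t) (at t)" "hoelder_class \<alpha> n K f'"
    using hoelder_class_SucE[OF Suc.prems(1)] by blast
  have "norm (f t) \<le> L" for t
    using hoelder_class_bound[OF Suc.prems(1), of t] Suc.prems(2) by linarith
  thus ?case using f'(1) Suc.IH[OF f'(2) Suc.prems(2)] by (rule hoelder_class_SucI)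
qed

lemma norm_diff_le_of_vector_derivative:
  fixes f :: "real \<Rightarrow> 'a::real_normed_vector"
  assumes "\<And>t. (f has_vector_derivative f' t) (at t)" "\<And>t. norm (f' t) \<le> K"
  shows "norm (f s - f t) \<le> K * \<bar>s - t\<bar>"
proof -
  have "onorm (\<lambda>h. h *\<^sub>R f' x) \<le> K" for x
    using assms(2)[of x] by (simp add: onorm_scaleR_left onorm_id)
  thus ?thesis
    using differentiable_bound[of UNIV f "\<lambda>x h. h *\<^sub>R f' x" K s t] assms(1)
    by (simp add: has_vector_derivative_def)
qed

text \<open>On [0, 1] a number is at most its power with exponent \<alpha> \<le> 1, and that power
  is monotone in the base. This serves to interpolate between a boundedness and a Lipschitz
  estimate.\<close>

lemma le_powr_of_le_one:
  fixes x y :: real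
  assumes "0 \<le> x" "x \<le> y" "x \<le> 1" "0 < \<alpha>" "\<alpha> \<le> 1"
  shows "x \<le> y powr \<alpha>"
proof (cases "x = 0")
  case False
  hence "x = x powr 1" using assms by simp
  also have "\<dots> \<le> x powr \<alpha>" using powr_mono'[of \<alpha> 1 x] assms by simp
  also have "\<dots> \<le> y powr \<alpha>" using assms by (intro powr_mono2) auto
  finally show ?thesis .
qed simp

text \<open>Divided by 2 * K, the difference is at most 1 and at most |s - t|, hence at most |s - t|
  to the power \<alpha>.\<close>

lemma hoelder_of_bounded_lipschitz:
  fixes f :: "real \<Rightarrow> 'a::real_normed_vector"
  assumes b: "\<And>t. norm (f t) \<le> K" and l: "\<And>s t. norm (f s - f t) \<le> K * \<bar>s - t\<bar>"
    and \<alpha>: "0 < \<alpha>" "\<alpha> \<le> 1"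
  shows "norm (f s - f t) \<le> 2 * K * \<bar>s - t\<bar> powr \<alpha>"
proof (cases "K = 0")
  case True
  thus ?thesis using l[of s t] by simp
next
  case False
  with b[of 0] norm_ge_zero[of "f 0"] have K: "K > 0" by linarith
  have "norm (f s - f t) \<le> 2 * K" using b[of s] b[of t] norm_triangle_ineq4[of "f s" "f t"] by linarith
  moreover have "norm (f s - f t) / (2 * K) \<le> \<bar>s - t\<bar>"
  proof -
    have "0 \<le> K * \<bar>s - t\<bar>" using K by simp
    hence "norm (f s - f t) \<le> 2 * K * \<bar>s - t\<bar>" using l[of s t] by linarith
    thus ?thesis using K by (simp add: field_simps)
  qed
  ultimately have "norm (f s - f t) / (2 * K) \<le> \<bar>s - t\<bar> powr \<alpha>"
    using K \<alpha> by (intro le_powr_of_le_one) auto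
  thus ?thesis using K by (simp add: field_simps)
qed

text \<open>Only the last derivative changes its role: its bound becomes a Lipschitz and then a
  Hoelder bound for the derivative before it. In a product rule this brings the undifferentiated
  factor down to the order of the differentiated one.\<close>

lemma hoelder_class_Suc:
  assumes "hoelder_class \<alpha> (Suc n) K f" "0 < \<alpha>" "\<alpha> \<le> 1"
  shows "hoelder_class \<alpha> n (2 * K) f"
  using assms(1)
proof (induction n arbitrary: f)
  case 0
  then obtain f' where f': "\<And>t. (f has_vector_derivative f' t) (at t)" "\<And>t. norm (f' t) \<le> K"
    and b: "\<And>t. norm (f t) \<le> K" by auto
  have "K \<ge> 0" using hoelder_class_nonneg[OF 0] .
  hence "norm (f t) \<le> 2 * K" for t using b[of t] by linarith
  thus ?case
    using hoelder_of_bounded_lipschitz[OF b norm_diff_le_of_vector_derivative[OF f'] assms(2,3)] by simp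
next
  case (Suc n)
  have "K \<ge> 0" using hoelder_class_nonneg[OF Suc.prems] .
  hence "norm (f t) \<le> 2 * K" for t using hoelder_class_bound[OF Suc.prems, of t] by linarith
  moreover obtain f' where "\<And>t. (f has_vector_derivative f' t) (at t)" "hoelder_class \<alpha> (Suc n) K f'"
    using hoelder_class_SucE[OF Suc.prems] by blast
  ultimately show ?case using Suc.IH by (intro hoelder_class_SucI)
qed

lemma hoelder_class_add:
  "hoelder_class \<alpha> n K f \<Longrightarrow> hoelder_class \<alpha> n L g \<Longrightarrow> hoelder_class \<alpha> n (K + L) (\<lambda>t. f t + g t)"
proof (induction n arbitrary: f g)
  case 0
  hence "norm (f s + g s - (f t + g t)) \<le> (K + L) * \<bar>s - t\<bar> powr \<alpha>" for s t
    using norm_diff_triangle_ineq[of "f s" "g s" "f t" "g t"]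
    by (fastforce simp: distrib_right intro: order_trans add_mono)
  moreover have "norm (f t + g t) \<le> K + L" for t
    using 0 norm_triangle_mono[of "f t" K "g t" L] by simp
  ultimately show ?case by simp
next
  case (Suc n)
  obtain f' where f': "\<And>t. (f has_vector_derivative f' t) (at t)" "hoelder_class \<alpha> n K f'"
    using hoelder_class_SucE[OF Suc.prems(1)] by blast
  obtain g' where g': "\<And>t. (g has_vector_derivative g' t) (at t)" "hoelder_class \<alpha> n L g'"
    using hoelder_class_SucE[OF Suc.prems(2)] by blast
  have "norm (f t + g t) \<le> K + L" for t
    using Suc.prems norm_triangle_mono[of "f t" K "g t" L] by simp
  moreover have "((\<lambda>t. f t + g t) has_vector_derivative f' t + g' t) (at t)" for t
    by (intro has_vector_derivative_add f' g')
  ultimately show ?case using Suc.IH[OF f'(2) g'(2)] by (intro hoelder_class_SucI)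
qed

text \<open>\<open>M\<close> is chosen before the functions, so it depends on \<alpha>, n,
  \<open>K\<close> and \<open>L\<close> only. The induction follows the product rule;
  \<open>K\<close> and \<open>L\<close> must vary because lowering the order of an undifferentiated
  factor doubles its bound.\<close>

lemma hoelder_class_mult:
  assumes \<alpha>: "0 < \<alpha>" "\<alpha> \<le> 1"
  shows "\<exists>M. \<forall>f g. hoelder_class \<alpha> n K f \<longrightarrow> hoelder_class \<alpha> n L g \<longrightarrow> hoelder_class \<alpha> n M (\<lambda>t. f t * g t)"
proof (induction n arbitrary: K L)
  case 0
  have "hoelder_class \<alpha> 0 (2 * K * L) (\<lambda>t. f t * g t)"
    if f: "hoelder_class \<alpha> 0 K f" and g: "hoelder_class \<alpha> 0 L g" for f g
  proof -
    note KL = hoelder_class_nonneg[OF f] hoelder_class_nonneg[OF g]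
    have "norm (f t * g t) \<le> K * L" for t
      using hoelder_class_bound[OF f] hoelder_class_bound[OF g] KL unfolding norm_mult by (intro mult_mono) auto
    moreover have "K * L \<le> 2 * K * L"
      using mult_nonneg_nonneg[OF KL] by linarith
    ultimately have "norm (f t * g t) \<le> 2 * K * L" for t
      using order_trans by blast
    moreover have "norm (f s * g s - f t * g t) \<le> 2 * K * L * \<bar>s - t\<bar> powr \<alpha>" for s t
    proof -
      have "f s * g s - f t * g t = f s * (g s - g t) + (f s - f t) * g t" by (simp add: algebra_simps)
      hence "norm (f s * g s - f t * g t) \<le> norm (f s) * norm (g s - g t) + norm (f s - f t) * norm (g t)"
        by (metis norm_mult norm_triangle_ineq)
      also have "\<dots> \<le> K * (L * \<bar>s - t\<bar> powr \<alpha>) + (K * \<bar>s - t\<bar> powr \<alpha>) * L"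
        using f g KL by (intro add_mono mult_mono) auto
      finally show ?thesis by (simp add: algebra_simps)
    qed
    ultimately show ?thesis by simp
  qed
  thus ?case by (intro exI[of _ "2 * K * L"]) blast
next
  case (Suc n)
  obtain M where M: "\<And>f g. hoelder_class \<alpha> n K f \<Longrightarrow> hoelder_class \<alpha> n (2 * L) g \<Longrightarrow> hoelder_class \<alpha> n M (\<lambda>t. f t * g t)"
    using Suc.IH[of K "2 * L"] by blast
  obtain N where N: "\<And>f g. hoelder_class \<alpha> n (2 * K) f \<Longrightarrow> hoelder_class \<alpha> n L g \<Longrightarrow> hoelder_class \<alpha> n N (\<lambda>t. f t * g t)"
    using Suc.IH[of "2 * K" L] by blast
  have "hoelder_class \<alpha> (Suc n) (max (K * L) (N + M)) (\<lambda>t. f t * g t)"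
    if f: "hoelder_class \<alpha> (Suc n) K f" and g: "hoelder_class \<alpha> (Suc n) L g" for f g
  proof -
    obtain f' where f': "\<And>t. (f has_vector_derivative f' t) (at t)" "hoelder_class \<alpha> n K f'"
      using hoelder_class_SucE[OF f] by blast
    obtain g' where g': "\<And>t. (g has_vector_derivative g' t) (at t)" "hoelder_class \<alpha> n L g'"
      using hoelder_class_SucE[OF g] by blast
    have "norm (f t * g t) \<le> K * L" for t
      using hoelder_class_bound[OF f] hoelder_class_bound[OF g] hoelder_class_nonneg[OF f]
      unfolding norm_mult by (intro mult_mono) auto
    moreover have "((\<lambda>t. f t * g t) has_vector_derivative f t * g' t + f' t * g t) (at t)" for t
      by (intro has_vector_derivative_mult f' g')
    moreover have "hoelder_class \<alpha> n (N + M) (\<lambda>t. f t * g' t + f' t * g t)"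
      by (rule hoelder_class_add[OF N[OF hoelder_class_Suc[OF f \<alpha>] g'(2)] M[OF f'(2) hoelder_class_Suc[OF g \<alpha>]]])
    ultimately show ?thesis
      using hoelder_class_mono[OF _ max.cobounded2]
      by (intro hoelder_class_SucI[where f' = "\<lambda>t. f t * g' t + f' t * g t"]) (auto simp: le_max_iff_disj)
  qed
  thus ?case by (intro exI[of _ "max (K * L) (N + M)"]) blast
qed

lemma hoelder_class_cmult:
  "hoelder_class \<alpha> n K f \<Longrightarrow> norm c \<le> 1 \<Longrightarrow> hoelder_class \<alpha> n K (\<lambda>t. c * f t)"
proof (induction n arbitrary: f)
  case 0
  have *: "norm (c * z) \<le> a" if "norm z \<le> a" for z a
    using that 0(2) mult_left_le_one_le[of "norm z" "norm c"] unfolding norm_mult by simp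
  have "norm (c * f t) \<le> K" "norm (c * f s - c * f t) \<le> K * \<bar>s - t\<bar> powr \<alpha>" for s t
    using 0 unfolding right_diff_distrib[symmetric] by (auto intro!: *)
  thus ?case by simp
next
  case (Suc n)
  obtain f' where f': "\<And>t. (f has_vector_derivative f' t) (at t)" "hoelder_class \<alpha> n K f'"
    using hoelder_class_SucE[OF Suc.prems(1)] by blast
  have "norm (c * f t) \<le> K" for t
    using hoelder_class_bound[OF Suc.prems(1), of t] Suc.prems(2) mult_left_le_one_le[of "norm (f t)" "norm c"]
    unfolding norm_mult by simp
  moreover have "((\<lambda>t. c * f t) has_vector_derivative c * f' t) (at t)" for t
    by (intro has_vector_derivative_mult_right f')
  ultimately show ?case using Suc.IH[OF f'(2) Suc.prems(2)] by (intro hoelder_class_SucI)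
qed

lemma norm_exp_i_diff_le: "norm (exp (\<i> * complex_of_real a) - exp (\<i> * complex_of_real b)) \<le> \<bar>a - b\<bar>"
proof -
  have "((\<lambda>t. exp (\<i> * complex_of_real t)) has_vector_derivative \<i> * exp (\<i> * complex_of_real t)) (at t)" for t
    by (auto intro!: derivative_eq_intros has_vector_derivative_real_field)
  from norm_diff_le_of_vector_derivative[OF this, of 1 a b] show ?thesis
    by (simp add: norm_mult)
qed

text \<open>Bounds are assumed for u' but not for u, since exp (i u) has modulus 1 however large u
  is. This matters because the rescaled phase itself grows with \<open>lam\<close> while its
  derivatives stay bounded.\<close>

lemma hoelder_class_exp:
  assumes \<alpha>: "0 < \<alpha>" "\<alpha> \<le> 1"
  shows "\<exists>M. \<forall>u u'. (\<forall>t. (u has_real_derivative u' t) (at t)) \<longrightarrow> hoelder_class \<alpha> n K (\<lambda>t. complex_of_real (u' t))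
    \<longrightarrow> hoelder_class \<alpha> (Suc n) M (\<lambda>t. exp (\<i> * complex_of_real (u t)))"
proof -
  define E :: "(real \<Rightarrow> real) \<Rightarrow> real \<Rightarrow> complex" where "E u t = exp (\<i> * complex_of_real (u t))" for u t
  have der: "(E u has_vector_derivative (\<i> * (complex_of_real (u' t) * E u t))) (at t)"
    if "\<And>t. (u has_real_derivative u' t) (at t)" for u u' t
  proof -
    have "((\<lambda>t. complex_of_real (u t)) has_vector_derivative complex_of_real (u' t)) (at t)"
      using that by (intro has_vector_derivative_of_real) 
    moreover have "((\<lambda>z. exp (\<i> * z)) has_field_derivative \<i> * exp (\<i> * complex_of_real (u t))) (at (complex_of_real (u t)))"
      by (auto intro!: derivative_eq_intros)
    ultimately have "((\<lambda>z. exp (\<i> * z)) \<circ> (\<lambda>t. complex_of_real (u t)) has_vector_derivative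
        complex_of_real (u' t) * (\<i> * exp (\<i> * complex_of_real (u t)))) (at t)"
      by (rule field_vector_diff_chain_at)
    thus ?thesis by (simp add: E_def[abs_def] o_def mult_ac)
  qed
  have E1: "norm (E u t) = 1" for u t by (simp add: E_def)
  \<comment> \<open>The bootstrap: E' = i u' E is a product of two functions of order n, so E has
    order n + 1.\<close>
  have step: "\<exists>M. \<forall>u u'. (\<forall>t. (u has_real_derivative u' t) (at t)) \<longrightarrow> hoelder_class \<alpha> n K (\<lambda>t. complex_of_real (u' t))
    \<longrightarrow> hoelder_class \<alpha> (Suc n) M (E u)"
    if L: "\<And>u u'. (\<forall>t. (u has_real_derivative u' t) (at t)) \<Longrightarrow> hoelder_class \<alpha> n K (\<lambda>t. complex_of_real (u' t))
      \<Longrightarrow> hoelder_class \<alpha> n L (E u)" for n K L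
  proof -
    obtain M where M: "\<And>f g. hoelder_class \<alpha> n K f \<Longrightarrow> hoelder_class \<alpha> n L g \<Longrightarrow> hoelder_class \<alpha> n M (\<lambda>t. f t * g t)"
      using hoelder_class_mult[OF \<alpha>, of n K L] by blast
    have "hoelder_class \<alpha> (Suc n) (max 1 M) (E u)"
      if u: "\<forall>t. (u has_real_derivative u' t) (at t)" and u': "hoelder_class \<alpha> n K (\<lambda>t. complex_of_real (u' t))" for u u'
    proof -
      have "hoelder_class \<alpha> n M (\<lambda>t. \<i> * (complex_of_real (u' t) * E u t))"
        using M[OF u' L[OF u u']] by (intro hoelder_class_cmult) auto
      thus ?thesis using der[of u u'] u E1
          hoelder_class_mono[OF _ max.cobounded2]
        by (intro hoelder_class_SucI[where f' = "\<lambda>t. \<i> * (complex_of_real (u' t) * E u t)"]) auto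
    qed
    thus ?thesis by (intro exI[of _ "max 1 M"]) blast
  qed
  have "\<exists>M. \<forall>u u'. (\<forall>t. (u has_real_derivative u' t) (at t)) \<longrightarrow> hoelder_class \<alpha> n K (\<lambda>t. complex_of_real (u' t))
    \<longrightarrow> hoelder_class \<alpha> (Suc n) M (E u)"
  proof (induction n arbitrary: K)
    case 0
    \<comment> \<open>The bootstrap starts from the Lipschitz bound of E; \<open>max 1 K\<close>
      dominates both |E| = 1 and |E'| \<le> K.\<close>
    have "hoelder_class \<alpha> 0 (2 * max 1 K) (E u)"
      if u: "\<forall>t. (u has_real_derivative u' t) (at t)" and u': "hoelder_class \<alpha> 0 K (\<lambda>t. complex_of_real (u' t))" for u u'
    proof -
      have "norm (\<i> * (complex_of_real (u' t) * E u t)) \<le> max 1 K" for t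
        using u' E1[of u t] by (auto simp: norm_mult le_max_iff_disj)
      hence "norm (E u s - E u t) \<le> max 1 K * \<bar>s - t\<bar>" for s t
        using u by (intro norm_diff_le_of_vector_derivative[OF der[of u u']]) auto
      from hoelder_of_bounded_lipschitz[OF _ this \<alpha>] show ?thesis
        by (simp add: E1)
    qed
    thus ?case by (rule step)
  next
    case (Suc n)
    \<comment> \<open>Lowering u' from order n + 1 to order n doubles its bound, so the induction
      hypothesis is taken at 2 * K.\<close>
    obtain L where "\<And>u u'. (\<forall>t. (u has_real_derivative u' t) (at t)) \<Longrightarrow> hoelder_class \<alpha> n (2 * K) (\<lambda>t. complex_of_real (u' t))
      \<Longrightarrow> hoelder_class \<alpha> (Suc n) L (E u)"
      using Suc.IH[of "2 * K"] by blast
    thus ?case using hoelder_class_Suc[OF _ \<alpha>] by (intro step[where L = L]) blast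
  qed
  thus ?thesis by (simp only: E_def[abs_def])
qed

text \<open>Differences commute with differentiation. By the mean value inequality, n of the n + 1
  differences are exchanged for derivatives at the price of a factor |h| each, and the remaining one
  uses the Hoelder condition of the n-th derivative.\<close>

lemma hoelder_class_iterated_difference:
  fixes \<Delta> :: "(real \<Rightarrow> complex) \<Rightarrow> real \<Rightarrow> complex"
  assumes "hoelder_class \<alpha> n K f" and \<Delta>: "\<Delta> = (\<lambda>f t. f (t + h) - f t)"
  shows "norm ((\<Delta> ^^ Suc n) f t) \<le> K * \<bar>h\<bar> powr \<alpha> * \<bar>h\<bar> ^ n"
  using assms(1)
proof (induction n arbitrary: f t)
  case 0
  hence "norm (f (t + h) - f t) \<le> K * \<bar>t + h - t\<bar> powr \<alpha>" by (simp only: hoelder_class.simps)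
  thus ?case by (simp add: \<Delta>)
next
  case (Suc n)
  obtain f' where f': "\<And>t. (f has_vector_derivative f' t) (at t)" "hoelder_class \<alpha> n K f'"
    using hoelder_class_SucE[OF Suc.prems(1)] by blast
  have der: "((\<Delta> ^^ r) f has_vector_derivative (\<Delta> ^^ r) f' t) (at t)" for r t
  proof (induction r arbitrary: t)
    case (Suc r)
    have "((\<lambda>t. (\<Delta> ^^ r) f (t + h)) has_vector_derivative (\<Delta> ^^ r) f' (t + h)) (at t)"
      using vector_diff_chain_at[of "\<lambda>t. t + h" 1 t "(\<Delta> ^^ r) f" "(\<Delta> ^^ r) f' (t + h)"] Suc.IH[of "t + h"]
      by (simp add: o_def has_vector_derivative_add_const)
    thus ?case using Suc.IH[of t] by (simp add: \<Delta> has_vector_derivative_diff)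
  qed (use f' in simp)
  have "norm ((\<Delta> ^^ Suc n) f (t + h) - (\<Delta> ^^ Suc n) f t) \<le> (K * \<bar>h\<bar> powr \<alpha> * \<bar>h\<bar> ^ n) * \<bar>t + h - t\<bar>"
    by (rule norm_diff_le_of_vector_derivative[OF der Suc.IH[OF f'(2)]])
  moreover have "(\<Delta> ^^ Suc (Suc n)) f t = (\<Delta> ^^ Suc n) f (t + h) - (\<Delta> ^^ Suc n) f t"
    by (subst funpow.simps(2)) (simp only: \<Delta> o_apply)
  ultimately show ?case by (simp add: mult_ac)
qed

subsection \<open>Regularity along coordinate lines\<close>

lemma torus_periodic_of_int:
  assumes "torus_periodic f"
  shows "f (x + (2*pi * of_int n) *\<^sub>R axis j 1) = f x"
proof (induction n rule: int_induct[where k = 0])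
  have step: "f (x + (2*pi * of_int (i + 1)) *\<^sub>R axis j 1) = f (x + (2*pi * of_int i) *\<^sub>R axis j 1)" for i
  proof -
    have "x + (2*pi * of_int (i + 1)) *\<^sub>R axis j 1 = (x + (2*pi * of_int i) *\<^sub>R axis j 1) + (2*pi) *\<^sub>R axis j 1"
      by (simp add: ring_distribs scaleR_left_distrib)
    thus ?thesis using assms by (simp only: torus_periodic_def)
  qed
  {
    case (step1 i)
    thus ?case by (simp only: step)
  next
    case (step2 i)
    thus ?case using step[of "i - 1"] by (simp only: diff_add_cancel)
  }
qed simp

text \<open>Shifting each coordinate by a whole number of periods brings any point into the compact
  period cube, where continuity gives a bound.\<close>

lemma torus_periodic_bounded:
  fixes f :: "real^'m \<Rightarrow> real"
  assumes c: "continuous_on UNIV f" and per: "torus_periodic f"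
  shows "\<exists>B. \<forall>x. \<bar>f x\<bar> \<le> B"
proof -
  have "compact (f ` cbox 0 (\<chi> i. 2*pi))"
    by (rule compact_continuous_image[OF continuous_on_subset[OF c]]) auto
  hence "\<exists>B. \<forall>y\<in>cbox 0 (\<chi> i. 2*pi). \<bar>f y\<bar> \<le> B"
    by (auto dest!: compact_imp_bounded simp: bounded_iff)
  then obtain B where B: "\<And>y. y \<in> cbox 0 (\<chi> i. 2*pi) \<Longrightarrow> \<bar>f y\<bar> \<le> B" by blast
  have "\<bar>f x\<bar> \<le> B" for x
  proof -
    define n where "n i = - \<lfloor>x $ i / (2*pi)\<rfloor>" for i
    define y where "y = x + (\<Sum>i\<in>UNIV. (2*pi * of_int (n i)) *\<^sub>R axis i 1)"
    have "f (x + (\<Sum>i\<in>S. (2*pi * of_int (n i)) *\<^sub>R axis i 1)) = f x" if "finite S" for S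
      using that
    proof induction
      case (insert a S)
      have eq: "x + (\<Sum>i\<in>insert a S. (2*pi * of_int (n i)) *\<^sub>R axis i 1)
        = (x + (\<Sum>i\<in>S. (2*pi * of_int (n i)) *\<^sub>R axis i 1)) + (2*pi * of_int (n a)) *\<^sub>R axis a 1"
        using insert by (simp add: add_ac)
      show ?case unfolding eq torus_periodic_of_int[OF per] by (rule insert.IH)
    qed simp
    hence "f y = f x" by (simp add: y_def)
    moreover have "y \<in> cbox 0 (\<chi> i. 2*pi)"
    proof -
      have yi: "y $ i = x $ i + 2*pi * of_int (n i)" for i
      proof -
        have "(\<Sum>k\<in>UNIV. (2*pi * of_int (n k)) *\<^sub>R axis k (1::real)) $ i
          = (\<Sum>k\<in>UNIV. if k = i then 2*pi * of_int (n k) else 0)"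
          unfolding sum_component by (intro sum.cong) (auto simp: axis_def)
        thus ?thesis by (simp add: y_def)
      qed
      have "0 \<le> y $ i \<and> y $ i \<le> 2*pi" for i
      proof -
        have "x $ i / (2*pi) + of_int (n i) \<ge> 0" "x $ i / (2*pi) + of_int (n i) \<le> 1"
          unfolding n_def by (simp, simp) linarith
        moreover have "y $ i = 2*pi * (x $ i / (2*pi) + of_int (n i))"
          unfolding yi by (simp add: field_simps)
        ultimately show ?thesis using mult_left_le[of "x $ i / (2*pi) + of_int (n i)" "2*pi"] by simp
      qed
      thus ?thesis by (simp add: mem_box_cart)
    qed
    ultimately show ?thesis using B[of y] by simp
  qed
  thus ?thesis by blast
qed

text \<open>Walking between two points one coordinate at a time adds up the axis constants to a
  global Lipschitz constant. This supplies the continuity of the phase, whose regularity is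
  otherwise used along coordinate lines only.\<close>

lemma continuous_on_of_axis_lipschitz:
  fixes f :: "real^'m \<Rightarrow> real"
  assumes "\<And>j. \<exists>K. \<forall>x h. \<bar>f (x + h *\<^sub>R axis j 1) - f x\<bar> \<le> K * \<bar>h\<bar>"
  shows "continuous_on UNIV f"
proof -
  obtain K where K: "\<And>j x h. \<bar>f (x + h *\<^sub>R axis j 1) - f x\<bar> \<le> K j * \<bar>h\<bar>"
    using assms by metis
  have K0: "0 \<le> K j" for j
    using order_trans[OF abs_ge_zero K[of 0 1 j]] by simp
  have sum: "\<bar>f (x + (\<Sum>i\<in>S. v i *\<^sub>R axis i 1)) - f x\<bar> \<le> (\<Sum>i\<in>S. K i * \<bar>v i\<bar>)" if "finite S" for S x v
    using that
  proof induction
    case (insert a S)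
    have eq: "x + (\<Sum>i\<in>insert a S. v i *\<^sub>R axis i 1) = (x + (\<Sum>i\<in>S. v i *\<^sub>R axis i 1)) + v a *\<^sub>R axis a 1"
      using insert by (simp add: add_ac)
    show ?case
      using insert K[of "x + (\<Sum>i\<in>S. v i *\<^sub>R axis i 1)" "v a" a] unfolding eq by simp
  qed simp
  have "(\<Sum>i\<in>UNIV. K i)-lipschitz_on UNIV f"
  proof (rule lipschitz_onI)
    fix x y :: "real^'m"
    have "(\<Sum>i\<in>UNIV. (x - y) $ i *\<^sub>R axis i 1) = x - y"
      using basis_expansion[of "x - y"] by (simp add: scalar_mult_eq_scaleR)
    hence "dist (f x) (f y) \<le> (\<Sum>i\<in>UNIV. K i * \<bar>(x - y) $ i\<bar>)"
      using sum[of UNIV y "\<lambda>i. (x - y) $ i"] by (simp add: dist_real_def)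
    also have "\<dots> \<le> (\<Sum>i\<in>UNIV. K i * norm (x - y))"
      by (intro sum_mono mult_left_mono component_le_norm_cart K0)
    finally show "dist (f x) (f y) \<le> (\<Sum>i\<in>UNIV. K i) * dist x y"
      by (simp add: dist_norm sum_distrib_right)
  qed (simp add: sum_nonneg K0)
  thus ?thesis by (rule lipschitz_on_continuous_on)
qed

lemma torus_periodic_iter_pd: "torus_periodic f \<Longrightarrow> torus_periodic (iter_pd js f)"
proof (induction js)
  case (Cons j js)
  have eq: "iter_pd js f (x + (2*pi) *\<^sub>R axis i 1 + h *\<^sub>R axis j 1) = iter_pd js f (x + h *\<^sub>R axis j 1)" for x i h
    using torus_periodic_shift[OF Cons.IH[OF Cons.prems], of "h *\<^sub>R axis j 1"] by (simp only: torus_periodic_def)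
  show ?case unfolding torus_periodic_def iter_pd.simps eq by simp
qed simp

text \<open>The class demands differentiability at h = 0 only, but for every base point; moving the
  base point along the line reaches every t.\<close>

lemma C_nu_alpha_line_derivative:
  assumes "C_nu_alpha \<nu> \<alpha> f" "length js < \<nu>"
  shows "((\<lambda>t. iter_pd js f (x + t *\<^sub>R axis j 1)) has_real_derivative iter_pd (j # js) f (x + t *\<^sub>R axis j 1)) (at t)"
proof -
  let ?F = "\<lambda>s. iter_pd js f (x + s *\<^sub>R axis j 1)"
  have eq: "(\<lambda>h. iter_pd js f (x + t *\<^sub>R axis j 1 + h *\<^sub>R axis j 1)) = (\<lambda>h. ?F (h + t))"
    by (simp add: scaleR_left_distrib add_ac)
  have "(\<lambda>h. iter_pd js f (x + t *\<^sub>R axis j 1 + h *\<^sub>R axis j 1)) differentiable (at 0)"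
    using assms by (simp add: C_nu_alpha_def)
  hence "((\<lambda>h. ?F (h + t)) has_real_derivative iter_pd (j # js) f (x + t *\<^sub>R axis j 1)) (at 0)"
    by (simp add: eq DERIV_deriv_iff_real_differentiable)
  thus ?thesis using DERIV_shift[of ?F _ 0 t] by simp
qed

lemma abs_diff_le_of_real_derivative:
  fixes f :: "real \<Rightarrow> real"
  assumes "\<And>t. (f has_real_derivative f' t) (at t)" "\<And>t. \<bar>f' t\<bar> \<le> K"
  shows "\<bar>f s - f t\<bar> \<le> K * \<bar>s - t\<bar>"
  using norm_diff_le_of_vector_derivative[of f f' K s t] assms
  by (simp add: has_real_derivative_iff_has_vector_derivative)

text \<open>\<open>d r\<close> plays the role of the r-th pure derivative along axis
  \<open>j\<close>; differences along one axis involve no mixed derivatives. For n = 0 the exponent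
  must be 1, which is how n + \<alpha> \<ge> 1 reads when 0 < \<alpha> \<le> 1.\<close>

locale axis_regular =
  fixes j :: "'m::finite" and d :: "nat \<Rightarrow> real^'m \<Rightarrow> real" and n :: nat and \<alpha> C :: real
  assumes alpha: "0 < \<alpha>" "\<alpha> \<le> 1" and alpha1: "n = 0 \<Longrightarrow> \<alpha> = 1"
    and der: "\<And>r x t. r < n \<Longrightarrow>
      ((\<lambda>t. d r (x + t *\<^sub>R axis j 1)) has_real_derivative d (Suc r) (x + t *\<^sub>R axis j 1)) (at t)"
    and per: "\<And>r. torus_periodic (d r)"
    and hoelder: "\<And>x h. \<bar>d n (x + h *\<^sub>R axis j 1) - d n x\<bar> \<le> C * \<bar>h\<bar> powr \<alpha>"
begin

lemma C_nonneg: "0 \<le> C"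
  using order_trans[OF abs_ge_zero hoelder[of 0 1]] by simp

text \<open>Periodicity makes each derivative of positive order vanish somewhere on every line.\<close>

lemma derivative_zero:
  assumes "r < n"
  obtains z where "0 < z" "z < 2*pi" "d (Suc r) (x + z *\<^sub>R axis j 1) = 0"
proof -
  have "\<exists>z. 0 < z \<and> z < 2*pi \<and> d r (x + (2*pi) *\<^sub>R axis j 1) - d r (x + 0 *\<^sub>R axis j 1)
      = (2*pi - 0) * d (Suc r) (x + z *\<^sub>R axis j 1)"
    by (rule MVT2) (use der[OF assms] in auto)
  thus ?thesis using per[of r] that by (auto simp: torus_periodic_def)
qed

text \<open>The bounds descend from the top order. Each derivative of positive order has a zero
  within one period of any point on a line, so the Hoelder condition bounds \<open>d n\<close>, and
  the mean value inequality then bounds each lower derivative in turn.\<close>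

lemma derivative_bound_aux:
  "m < n \<Longrightarrow> \<bar>d (n - m) x\<bar> \<le> C * (2*pi) powr \<alpha> * (2*pi) ^ m"
proof (induction m arbitrary: x)
  case 0
  obtain z where z: "0 < z" "z < 2*pi" "d n (x + z *\<^sub>R axis j 1) = 0"
    using derivative_zero[of "n - 1" x] 0 by auto
  have "\<bar>d n x\<bar> \<le> C * \<bar>z\<bar> powr \<alpha>" using hoelder[of x z] z(3) by simp
  also have "\<dots> \<le> C * (2*pi) powr \<alpha>"
    using z alpha C_nonneg by (intro mult_left_mono powr_mono2) auto
  finally show ?case by simp
next
  case (Suc m)
  define r where "r = n - Suc m"
  have r: "r < n" "n - m = Suc r" "Suc (r - 1) = r" "r - 1 < n" using Suc.prems by (auto simp: r_def)
  obtain z where z: "0 < z" "z < 2*pi" "d r (x + z *\<^sub>R axis j 1) = 0"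
    using derivative_zero[OF r(4), of x] r(3) by auto
  have "\<bar>d r (x + z *\<^sub>R axis j 1) - d r (x + 0 *\<^sub>R axis j 1)\<bar> \<le> (C * (2*pi) powr \<alpha> * (2*pi) ^ m) * \<bar>z - 0\<bar>"
    using Suc.IH Suc.prems r(2) by (intro abs_diff_le_of_real_derivative[OF der[OF r(1)]]) auto
  also have "\<dots> \<le> (C * (2*pi) powr \<alpha> * (2*pi) ^ m) * (2*pi)"
    using z C_nonneg by (intro mult_left_mono mult_nonneg_nonneg) auto
  finally show ?case using z(3) by (simp add: r_def mult_ac)
qed

text \<open>Since 2 pi > 1, the exponent n - r of the individual bounds may be enlarged to n. Order
  0 is excluded because \<open>d 0\<close> need not vanish anywhere.\<close>

lemma derivative_bound:
  "\<exists>B\<ge>0. \<forall>r x. 0 < r \<longrightarrow> r \<le> n \<longrightarrow> \<bar>d r x\<bar> \<le> B"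
proof (intro exI[of _ "C * (2*pi) powr \<alpha> * (2*pi) ^ n"] conjI allI impI)
  show "0 \<le> C * (2*pi) powr \<alpha> * (2*pi) ^ n" using C_nonneg by simp
  fix r x assume r: "0 < r" "r \<le> n"
  have "\<bar>d r x\<bar> \<le> C * (2*pi) powr \<alpha> * (2*pi) ^ (n - r)"
    using derivative_bound_aux[of "n - r" x] r by simp
  also have "\<dots> \<le> C * (2*pi) powr \<alpha> * (2*pi) ^ n"
    using C_nonneg pi_gt3 by (intro mult_left_mono power_increasing) auto
  finally show "\<bar>d r x\<bar> \<le> C * (2*pi) powr \<alpha> * (2*pi) ^ n" .
qed

lemma axis_lipschitz: "\<exists>K. \<forall>x h. \<bar>d 0 (x + h *\<^sub>R axis j 1) - d 0 x\<bar> \<le> K * \<bar>h\<bar>"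
proof (cases n)
  case 0
  thus ?thesis using hoelder alpha1 by (auto intro!: exI[of _ C])
next
  case (Suc n')
  obtain B where B: "\<And>r x. 0 < r \<Longrightarrow> r \<le> n \<Longrightarrow> \<bar>d r x\<bar> \<le> B" using derivative_bound by blast
  have "\<bar>d 0 (x + h *\<^sub>R axis j 1) - d 0 (x + 0 *\<^sub>R axis j 1)\<bar> \<le> B * \<bar>h - 0\<bar>" for x h
  proof (rule abs_diff_le_of_real_derivative[OF der])
    show "0 < n" using Suc by simp
    show "\<bar>d (Suc 0) (x + t *\<^sub>R axis j 1)\<bar> \<le> B" for t using Suc by (intro B) auto
  qed
  thus ?thesis by (intro exI[of _ B]) simp
qed

end

section \<open>Iterated differences along an axis\<close>

definition axis_difference :: "'m \<Rightarrow> real \<Rightarrow> (real^'m \<Rightarrow> complex) \<Rightarrow> real^'m \<Rightarrow> complex" where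
  "axis_difference j h f = (\<lambda>x. f (x + h *\<^sub>R axis j 1) - f x)"

text \<open>The three claims are proved together, because the multiplier of one more difference is
  obtained from continuity and periodicity of the previous iterate.\<close>

lemma iterated_axis_difference_fourier:
  fixes f :: "real^'m \<Rightarrow> complex" and j :: 'm
  assumes c: "continuous_on UNIV f" and per: "torus_periodic f" and h: "0 \<le> h" "h \<le> 2*pi"
  defines "g \<equiv> \<lambda>n. (axis_difference j h ^^ n) f"
  shows "continuous_on UNIV (g n)" "torus_periodic (g n)"
    and "fourier_coeff (g n) k = (exp (\<i> * complex_of_real (of_int (k$j) * h)) - 1) ^ n * fourier_coeff f k"
proof -
  have "continuous_on UNIV (g n) \<and> torus_periodic (g n) \<and>
    fourier_coeff (g n) k = (exp (\<i> * complex_of_real (of_int (k$j) * h)) - 1) ^ n * fourier_coeff f k"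
  proof (induction n)
    case (Suc n)
    have g: "g (Suc n) = (\<lambda>t. g n (t + h *\<^sub>R axis j 1) - g n t)"
      by (simp add: g_def axis_difference_def)
    have "continuous_on UNIV (\<lambda>t. g n (t + h *\<^sub>R axis j 1))"
      by (rule continuous_on_compose2[of UNIV "g n"]) (use Suc in \<open>auto intro!: continuous_intros\<close>)
    moreover have "torus_periodic (g (Suc n))"
      using torus_periodic_shift[of "g n" "h *\<^sub>R axis j 1"] Suc by (simp add: g torus_periodic_def)
    ultimately show ?case
      using Suc fourier_coeff_difference[of "g n" h j k] h by (auto simp: g intro!: continuous_intros)
  qed (simp add: g_def c per)
  thus "continuous_on UNIV (g n)" "torus_periodic (g n)"
    "fourier_coeff (g n) k = (exp (\<i> * complex_of_real (of_int (k$j) * h)) - 1) ^ n * fourier_coeff f k"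
    by auto
qed

text \<open>A step \<open>h\<close> along the axis is a step L * h in the parameter t of the dilated
  line.\<close>

lemma iterated_axis_difference_line:
  assumes "L \<noteq> 0"
  shows "(axis_difference j h ^^ n) f (x + (t / L) *\<^sub>R axis j 1)
    = ((\<lambda>g t. g (t + L * h) - g t) ^^ n) (\<lambda>t. f (x + (t / L) *\<^sub>R axis j 1)) t"
proof (induction n arbitrary: t)
  case (Suc n)
  have eq: "x + (t / L) *\<^sub>R axis j 1 + h *\<^sub>R axis j 1 = x + ((t + L * h) / L) *\<^sub>R axis j 1"
    using assms by (simp add: add_divide_distrib scaleR_left_distrib)
  show ?case
    unfolding funpow.simps(2) o_apply axis_difference_def[of j h "(axis_difference j h ^^ n) f"] eq Suc ..
qed simp

text \<open>After rescaling the variable by \<open>\<bar>lam\<bar>\<close>, all derivatives of the phase are bounded independently of \<open>lam\<close>.\<close>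

lemma (in axis_regular) exp_iterated_difference_bound:
  "\<exists>K. \<forall>lam h x. 1 \<le> \<bar>lam\<bar> \<longrightarrow> 0 < h \<longrightarrow>
    norm ((axis_difference j h ^^ Suc n) (\<lambda>x. exp (\<i> * complex_of_real (lam * d 0 x))) x) \<le> K * (\<bar>lam\<bar> * h) powr (n + \<alpha>)"
proof (cases n)
  case 0
  \<comment> \<open>For n = 0 the exponent is 1, and the single difference is estimated directly by
    the Lipschitz condition.\<close>
  have "norm ((axis_difference j h ^^ Suc n) (\<lambda>x. exp (\<i> * complex_of_real (lam * d 0 x))) x) \<le> C * (\<bar>lam\<bar> * h) powr (n + \<alpha>)"
    if "0 < h" for lam h x
  proof -
    have "norm ((axis_difference j h ^^ Suc n) (\<lambda>x. exp (\<i> * complex_of_real (lam * d 0 x))) x)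
      \<le> \<bar>lam * d 0 (x + h *\<^sub>R axis j 1) - lam * d 0 x\<bar>"
      unfolding 0 by (simp add: axis_difference_def del: of_real_mult) (rule norm_exp_i_diff_le)
    also have "\<dots> = \<bar>lam\<bar> * \<bar>d 0 (x + h *\<^sub>R axis j 1) - d 0 x\<bar>"
      by (simp add: right_diff_distrib[symmetric] abs_mult)
    also have "\<dots> \<le> \<bar>lam\<bar> * (C * h)"
      using hoelder[of x h] 0 alpha1 that by (intro mult_left_mono) auto
    finally show ?thesis using that 0 alpha1 by (simp add: mult_ac)
  qed
  thus ?thesis by blast
next
  case (Suc n')
  obtain B where B: "0 \<le> B" "\<And>r x. 0 < r \<Longrightarrow> r \<le> n \<Longrightarrow> \<bar>d r x\<bar> \<le> B" using derivative_bound by blast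
  define K where "K = max B C"
  obtain M where M: "\<And>u u'. (\<forall>t. (u has_real_derivative u' t) (at t)) \<Longrightarrow> hoelder_class \<alpha> n' K (\<lambda>t. complex_of_real (u' t))
    \<Longrightarrow> hoelder_class \<alpha> (Suc n') M (\<lambda>t. exp (\<i> * complex_of_real (u t)))"
    using hoelder_class_exp[OF alpha, of n' K] by blast
  have "norm ((axis_difference j h ^^ Suc n) (\<lambda>x. exp (\<i> * complex_of_real (lam * d 0 x))) x) \<le> M * (\<bar>lam\<bar> * h) powr (n + \<alpha>)"
    if lam: "1 \<le> \<bar>lam\<bar>" and h: "0 < h" for lam h x
  proof -
    define L where "L = \<bar>lam\<bar>"
    \<comment> \<open>\<open>D r\<close> is the r-th derivative of the rescaled phase. Its prefactor
      has modulus at most 1 for r \<ge> 1, but modulus |lam| for r = 0.\<close>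
    define D where "D r t = lam / L ^ r * d r (x + (t / L) *\<^sub>R axis j 1)" for r t
    have "1 \<le> L" using lam by (simp add: L_def)
    hence L: "1 \<le> L" "L \<noteq> 0" by linarith+
    have c: "\<bar>lam / L ^ r\<bar> \<le> 1" if "0 < r" for r
      using L that power_increasing[of 1 r L] by (simp add: abs_divide L_def)
    have D': "(D r has_real_derivative D (Suc r) t) (at t)" if "r < n" for r t
    proof -
      have "((\<lambda>t. t / L) has_real_derivative 1 / L) (at t)"
        using L by (auto intro!: derivative_eq_intros)
      from DERIV_chain2[OF der[OF that, of x "t / L"] this] 
      have "((\<lambda>t. d r (x + (t / L) *\<^sub>R axis j 1)) has_real_derivative d (Suc r) (x + (t / L) *\<^sub>R axis j 1) * (1 / L)) (at t)" .
      from DERIV_cmult[OF this, of "lam / L ^ r"] show ?thesis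
        by (simp add: D_def[abs_def] mult_ac)
    qed
    have Db: "\<bar>D r t\<bar> \<le> K" if "0 < r" "r \<le> n" for r t
    proof -
      have "\<bar>D r t\<bar> \<le> 1 * B"
        unfolding D_def abs_mult using that c B by (intro mult_mono) auto
      thus ?thesis by (simp add: K_def)
    qed
    \<comment> \<open>\<open>m\<close> counts down from the top order, and m < n stops the descent
      at \<open>D 1\<close>, the lowest order that is bounded uniformly in
      \<open>lam\<close>.\<close>
    have H: "hoelder_class \<alpha> m K (\<lambda>t. complex_of_real (D (n - m) t))" if "m < n" for m
      using that
    proof (induction m)
      case 0
      have "\<bar>D n s - D n t\<bar> \<le> K * \<bar>s - t\<bar> powr \<alpha>" for s t
      proof -
        have "\<bar>D n s - D n t\<bar> = \<bar>lam / L ^ n\<bar> * \<bar>d n (x + (t / L) *\<^sub>R axis j 1 + ((s - t) / L) *\<^sub>R axis j 1) - d n (x + (t / L) *\<^sub>R axis j 1)\<bar>"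
        proof -
          have "x + (t / L) *\<^sub>R axis j 1 + ((s - t) / L) *\<^sub>R axis j 1 = x + (s / L) *\<^sub>R axis j 1"
            by (simp add: diff_divide_distrib scaleR_left_diff_distrib)
          thus ?thesis unfolding D_def right_diff_distrib[symmetric] abs_mult by (simp only:)
        qed
        also have "\<dots> \<le> 1 * (C * \<bar>(s - t) / L\<bar> powr \<alpha>)"
          using 0 by (intro mult_mono c hoelder) auto
        also have "\<dots> \<le> 1 * (K * \<bar>s - t\<bar> powr \<alpha>)"
          using L alpha C_nonneg
          by (intro mult_left_mono mult_mono powr_mono2) (auto simp: K_def divide_le_eq mult_le_cancel_left1)
        finally show ?thesis by simp
      qed
      thus ?case using Db[of n] 0 by (simp flip: of_real_diff)
    next
      case (Suc m)
      have m: "Suc (n - Suc m) = n - m" using Suc.prems by simp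
      have "((\<lambda>t. complex_of_real (D (n - Suc m) t)) has_vector_derivative complex_of_real (D (n - m) t)) (at t)" for t
        using D'[of "n - Suc m" t] Suc.prems m by (intro has_vector_derivative_of_real) simp
      thus ?case using Db[of "n - Suc m"] Suc by (intro hoelder_class_SucI) auto
    qed
    \<comment> \<open>\<open>D 1\<close> has n' = n - 1 further derivatives under control, so the
      exponential gains one and has order n.\<close>
    have "hoelder_class \<alpha> n M (\<lambda>t. exp (\<i> * complex_of_real (D 0 t)))"
      using M[of "D 0" "D 1"] D'[of 0] H[of n'] Suc by simp
    hence "norm (((\<lambda>g t. g (t + L * h) - g t) ^^ Suc n) (\<lambda>t. exp (\<i> * complex_of_real (D 0 t))) 0)
      \<le> M * \<bar>L * h\<bar> powr \<alpha> * \<bar>L * h\<bar> ^ n"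
      by (rule hoelder_class_iterated_difference) simp
    \<comment> \<open>At t = 0 the dilated line passes through x, and its step |lam| * h is the
      original step \<open>h\<close> along the axis.\<close>
    moreover have "((\<lambda>g t. g (t + L * h) - g t) ^^ Suc n) (\<lambda>t. exp (\<i> * complex_of_real (D 0 t))) 0
      = (axis_difference j h ^^ Suc n) (\<lambda>x. exp (\<i> * complex_of_real (lam * d 0 x))) x"
      using iterated_axis_difference_line[OF L(2), where j = j and h = h and n = "Suc n" and x = x and t = 0
          and f = "\<lambda>x. exp (\<i> * complex_of_real (lam * d 0 x))"]
      by (simp add: D_def del: funpow.simps)
    moreover have "\<bar>L * h\<bar> powr \<alpha> * \<bar>L * h\<bar> ^ n = (L * h) powr (n + \<alpha>)"
      using L h by (simp add: powr_add powr_realpow)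
    ultimately show ?thesis by (simp add: L_def mult.assoc del: funpow.simps)
  qed
  thus ?thesis by blast
qed

text \<open>For \<alpha> = 0 the pair (\<nu>, 0) is replaced by (\<nu> - 1, 1): the top derivative
  is continuous and periodic, hence bounded, so the derivative below it is Lipschitz. The sum of
  order and exponent stays the same.\<close>

lemma C_nu_alpha_axis_regular:
  fixes f :: "real^'m \<Rightarrow> real"
  assumes f: "C_nu_alpha \<nu> \<alpha> f" and \<alpha>: "0 \<le> \<alpha>" "\<alpha> \<le> 1" "real \<nu> + \<alpha> \<ge> 1"
  obtains n \<beta> where "real n + \<beta> = real \<nu> + \<alpha>"
    "\<And>j. \<exists>d C. axis_regular j d n \<beta> C \<and> d 0 = f"
proof -
  define d where "d j r = iter_pd (replicate r j) f" for j r
  have per: "torus_periodic (d j r)" for j r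
    using f torus_periodic_iter_pd unfolding C_nu_alpha_def d_def by blast
  have der: "((\<lambda>t. d j r (x + t *\<^sub>R axis j 1)) has_real_derivative d j (Suc r) (x + t *\<^sub>R axis j 1)) (at t)"
    if "r < \<nu>" for j r x t
    using C_nu_alpha_line_derivative[OF f, of "replicate r j" x j t] that by (simp add: d_def)
  show ?thesis
  proof (cases "\<alpha> = 0")
    case False
    have "\<exists>C. axis_regular j (d j) \<nu> \<alpha> C" for j
    proof -
      obtain C where C: "\<And>x y. \<bar>d j \<nu> x - d j \<nu> y\<bar> \<le> C * norm (x - y) powr \<alpha>"
        using f False unfolding C_nu_alpha_def d_def by (metis length_replicate)
      have "\<bar>d j \<nu> (x + h *\<^sub>R axis j 1) - d j \<nu> x\<bar> \<le> C * \<bar>h\<bar> powr \<alpha>" for x h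
        using C[of "x + h *\<^sub>R axis j 1" x] by simp
      hence "axis_regular j (d j) \<nu> \<alpha> C"
        using \<alpha> False per der by unfold_locales auto
      thus ?thesis ..
    qed
    thus ?thesis using that[of \<nu> \<alpha>] by (metis d_def iter_pd.simps(1) replicate_0)
  next
    case True
    then obtain n where n: "\<nu> = Suc n" using \<alpha> by (cases \<nu>) auto
    have "\<exists>C. axis_regular j (d j) n 1 C" for j
    proof -
      have "continuous_on UNIV (d j \<nu>)"
        using f True by (simp add: C_nu_alpha_def d_def)
      then obtain B where B: "\<And>x. \<bar>d j \<nu> x\<bar> \<le> B" using torus_periodic_bounded[OF _ per] by blast
      have "\<bar>d j n (x + h *\<^sub>R axis j 1) - d j n (x + 0 *\<^sub>R axis j 1)\<bar> \<le> B * \<bar>h - 0\<bar>" for x h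
        using B n by (intro abs_diff_le_of_real_derivative[OF der]) auto
      hence "axis_regular j (d j) n 1 B"
        using per der n by unfold_locales auto
      thus ?thesis ..
    qed
    thus ?thesis using that[of n 1] True n by (metis add.commute add.right_neutral d_def iter_pd.simps(1) of_nat_Suc replicate_0)
  qed
qed

subsection \<open>Dyadic blocks of Fourier coefficients\<close>

lemma card_int_cube:
  fixes N :: real
  assumes "1 \<le> N"
  defines "A \<equiv> {k :: int^'m. \<forall>j. \<bar>of_int (k $ j)\<bar> \<le> N}"
  shows "finite A" "real (card A) \<le> (3 * N) ^ CARD('m)"
proof -
  define I where "I = {- \<lfloor>N\<rfloor>..\<lfloor>N\<rfloor>}"
  have sub: "vec_nth ` A \<subseteq> (PiE UNIV (\<lambda>_. I))"
  proof -
    have "k $ j \<in> I" if "k \<in> A" for k j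
    proof -
      have "\<bar>real_of_int (k $ j)\<bar> \<le> N" using that by (simp add: A_def)
      hence "k $ j \<le> \<lfloor>N\<rfloor>" "- (k $ j) \<le> \<lfloor>N\<rfloor>" by (simp_all add: le_floor_iff abs_le_iff)
      thus ?thesis by (simp add: I_def)
    qed
    thus ?thesis by auto
  qed
  have inj: "inj_on vec_nth A" by (auto simp: inj_on_def vec_eq_iff)
  have fin: "finite (PiE (UNIV :: 'm set) (\<lambda>_. I))" by (intro finite_PiE) (auto simp: I_def)
  show "finite A" using finite_imageD[OF finite_subset[OF sub fin] inj] .
  have "card A = card (vec_nth ` A)" using inj by (simp add: card_image)
  also have "\<dots> \<le> card (PiE (UNIV :: 'm set) (\<lambda>_. I))" by (rule card_mono[OF fin sub])
  also have "\<dots> = card I ^ CARD('m)" by (simp add: card_PiE)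
  finally have le: "real (card A) \<le> real (card I) ^ CARD('m)" by (simp flip: of_nat_power)
  \<comment> \<open>The left side counts the admissible values of one coordinate; N \<ge> 1 absorbs
    the summand 1.\<close>
  have "2 * real_of_int \<lfloor>N\<rfloor> + 1 \<le> 3 * N"
    using assms(1) of_int_floor_le[of N] by linarith
  hence "real (card I) \<le> 3 * N"
    using assms(1) by (simp add: I_def)
  hence "real (card I) ^ CARD('m) \<le> (3 * N) ^ CARD('m)" by (intro power_mono) auto
  with le show "real (card A) \<le> (3 * N) ^ CARD('m)" by linarith
qed

text \<open>This replaces Hoelder's inequality: summed over a finite set, it yields the \<open>l\<^sup>p\<close>-bound after choosing the threshold \<open>\<tau>\<close>.\<close>

lemma powr_le_threshold:
  fixes a p \<tau> :: real
  assumes "0 \<le> a" "0 < \<tau>" "0 < p" "p \<le> 2"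
  shows "a powr p \<le> \<tau> powr p + \<tau> powr (p - 2) * a\<^sup>2"
proof (cases "a \<le> \<tau>")
  case True
  have "a powr p \<le> \<tau> powr p" using True assms by (intro powr_mono2) auto
  thus ?thesis by (simp add: add_increasing2)
next
  case False
  hence a: "0 < a" using assms by linarith
  have "a powr p = a powr (p - 2) * a\<^sup>2"
    using a by (simp add: powr_diff)
  also have "\<dots> \<le> \<tau> powr (p - 2) * a\<^sup>2"
    using False assms by (intro mult_right_mono powr_mono2') auto
  finally show ?thesis by (simp add: add_increasing)
qed

text \<open>In this range cos x \<le> 0, so the real part is at most -1. The lower bound 1 survives
  every power, hence every iterated difference.\<close>

lemma norm_exp_i_minus_one_ge:
  assumes "pi / 2 \<le> \<bar>x\<bar>" "\<bar>x\<bar> \<le> pi"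
  shows "1 \<le> norm (exp (\<i> * complex_of_real x) - 1)"
proof -
  have "0 \<le> cos (pi - \<bar>x\<bar>)" using assms by (intro cos_ge_zero) auto
  hence "cos x \<le> 0" by (cases "0 \<le> x") auto
  moreover have "Re (exp (\<i> * complex_of_real x) - 1) = cos x - 1"
    by (simp add: Re_exp)
  ultimately show ?thesis
    using abs_Re_le_cmod[of "exp (\<i> * complex_of_real x) - 1"] by simp
qed

text \<open>With step pi / N, a coordinate between N / 2 and N gives an angle between pi / 2 and pi,
  so the difference multiplier has modulus at least 1. Bessel's inequality for the difference along
  \<open>j\<close> then handles all frequencies whose \<open>j\<close>-th coordinate is
  large.\<close>

lemma fourier_coeff_block_bound:
  fixes f :: "real^'m \<Rightarrow> complex"
  assumes c: "continuous_on UNIV f" and per: "torus_periodic f" and N: "1 \<le> N" and F: "finite F"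
    and E: "\<And>j x. norm ((axis_difference j (pi / N) ^^ n) f x) \<le> E"
    and block: "\<And>k. k \<in> F \<Longrightarrow> (\<forall>j. \<bar>of_int (k $ j)\<bar> \<le> N) \<and> (\<exists>j. N < 2 * \<bar>of_int (k $ j)\<bar>)"
  shows "(\<Sum>k\<in>F. (norm (fourier_coeff f k))\<^sup>2) \<le> real CARD('m) * E\<^sup>2"
proof -
  have "pi / N \<le> pi / 1" using N by (intro divide_left_mono) auto
  hence h: "0 \<le> pi / N" "pi / N \<le> 2 * pi" using N pi_gt_zero by (simp, linarith)
  define G where "G j = {k \<in> F. N < 2 * \<bar>real_of_int (k $ j)\<bar>}" for j
  have G: "(\<Sum>k\<in>G j. (norm (fourier_coeff f k))\<^sup>2) \<le> E\<^sup>2" for j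
  proof -
    define g where "g = (axis_difference j (pi / N) ^^ n) f"
    have "norm (fourier_coeff f k) \<le> norm (fourier_coeff g k)" if "k \<in> G j" for k
    proof -
      define x where "x = real_of_int (k $ j) * (pi / N)"
      have "\<bar>x\<bar> = pi * (\<bar>real_of_int (k $ j)\<bar> / N)" using N by (simp add: x_def abs_mult)
      moreover have "1 / 2 \<le> \<bar>real_of_int (k $ j)\<bar> / N" "\<bar>real_of_int (k $ j)\<bar> / N \<le> 1"
        using that block[of k] N by (auto simp: G_def field_simps)
      ultimately have "pi / 2 \<le> \<bar>x\<bar>" "\<bar>x\<bar> \<le> pi"
        using mult_left_mono[of "1/2" "\<bar>real_of_int (k $ j)\<bar> / N" pi]
          mult_left_mono[of "\<bar>real_of_int (k $ j)\<bar> / N" 1 pi] by simp_all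
      hence "1 \<le> norm (exp (\<i> * complex_of_real x) - 1) ^ n"
        by (intro one_le_power norm_exp_i_minus_one_ge)
      hence "1 * norm (fourier_coeff f k) \<le> norm (exp (\<i> * complex_of_real x) - 1) ^ n * norm (fourier_coeff f k)"
        by (intro mult_right_mono) auto
      moreover have "fourier_coeff g k = (exp (\<i> * complex_of_real x) - 1) ^ n * fourier_coeff f k"
        unfolding g_def x_def by (rule iterated_axis_difference_fourier(3)[OF c per h])
      ultimately show ?thesis by (simp add: norm_mult norm_power)
    qed
    hence "(\<Sum>k\<in>G j. (norm (fourier_coeff f k))\<^sup>2) \<le> (\<Sum>k\<in>G j. (norm (fourier_coeff g k))\<^sup>2)"
      by (intro sum_mono power_mono) auto
    also have "\<dots> \<le> E\<^sup>2"
      unfolding g_def using F E by (intro bessel_fourier_coeff iterated_axis_difference_fourier(1) c per h) (auto simp: G_def)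
    finally show ?thesis .
  qed
  \<comment> \<open>The sets \<open>G j\<close> cover \<open>F\<close> but may overlap; counting a
    frequency several times only enlarges the right side.\<close>
  have "(\<Sum>k\<in>F. (norm (fourier_coeff f k))\<^sup>2) \<le> (\<Sum>k\<in>F. \<Sum>j\<in>UNIV. if k \<in> G j then (norm (fourier_coeff f k))\<^sup>2 else 0)"
  proof (rule sum_mono)
    fix k assume k: "k \<in> F"
    then obtain j where "k \<in> G j" using block[of k] by (auto simp: G_def)
    thus "(norm (fourier_coeff f k))\<^sup>2 \<le> (\<Sum>j\<in>UNIV. if k \<in> G j then (norm (fourier_coeff f k))\<^sup>2 else 0)"
      using member_le_sum[of j UNIV "\<lambda>j. if k \<in> G j then (norm (fourier_coeff f k))\<^sup>2 else 0"] by simp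
  qed
  also have "\<dots> = (\<Sum>j\<in>UNIV. \<Sum>k\<in>F. if k \<in> G j then (norm (fourier_coeff f k))\<^sup>2 else 0)"
    by (rule sum.swap)
  also have "\<dots> = (\<Sum>j\<in>UNIV. \<Sum>k\<in>G j. (norm (fourier_coeff f k))\<^sup>2)"
  proof (rule sum.cong[OF refl])
    fix j :: 'm
    have "F \<inter> G j = G j" by (auto simp: G_def)
    thus "(\<Sum>k\<in>F. if k \<in> G j then (norm (fourier_coeff f k))\<^sup>2 else 0) = (\<Sum>k\<in>G j. (norm (fourier_coeff f k))\<^sup>2)"
      using sum.inter_restrict[OF F, of "\<lambda>k. (norm (fourier_coeff f k))\<^sup>2" "G j"] by simp
  qed
  also have "\<dots> \<le> (\<Sum>j\<in>(UNIV :: 'm set). E\<^sup>2)" by (intro sum_mono G)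
  finally show ?thesis by simp
qed

text \<open>Block \<open>i\<close> has O((2^i q)^m) points with m = \<open>CARD('m)\<close> and an
  l2 mass that decays like 2^(-s i); its lp sum is therefore a multiple of q^w times the i-th power
  of 2^(w - s p), a ratio below 1.\<close>

lemma sum_powr_dyadic_blocks_le:
  fixes a :: "int^'m \<Rightarrow> real" and p q s D :: real
  defines "w \<equiv> real CARD('m) * (1 - p / 2)"
  assumes a: "\<And>k. 0 \<le> a k" and p: "0 < p" "p \<le> 2" and q: "1 \<le> q" and ws: "w < s * p" and D: "0 \<le> D"
    and block: "\<And>i F. finite F \<Longrightarrow> (\<And>k. k \<in> F \<Longrightarrow> (\<forall>j. \<bar>of_int (k $ j)\<bar> \<le> 2 ^ i * q)) \<Longrightarrow>
      (\<And>k. k \<in> F \<Longrightarrow> 0 < i \<Longrightarrow> (\<exists>j. 2 ^ i * q < 2 * \<bar>of_int (k $ j)\<bar>)) \<Longrightarrow>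
      (\<Sum>k\<in>F. (a k)\<^sup>2) \<le> D * (2 powr (- s * real i))\<^sup>2"
    and F: "finite F"
  shows "(\<Sum>k\<in>F. a k powr p) \<le> (3 ^ CARD('m) + D) / (1 - 2 powr (w - s * p)) * q powr w"
proof -
  define \<rho> where "\<rho> = 2 powr (w - s * p)"
  have "\<rho> < 2 powr 0" unfolding \<rho>_def using ws by (intro powr_less_mono) auto
  hence \<rho>: "0 < \<rho>" "\<rho> < 1" by (simp_all add: \<rho>_def)
  \<comment> \<open>Leastness places some coordinate above half the radius in every block except
    block 0, which is the whole cube of radius \<open>q\<close>.\<close>
  define idx where "idx k = (LEAST i. \<forall>j. \<bar>real_of_int (k $ j)\<bar> \<le> 2 ^ i * q)" for k :: "int^'m"
  have idx: "\<forall>j. \<bar>real_of_int (k $ j)\<bar> \<le> 2 ^ idx k * q" for k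
  proof -
    obtain i where i: "(\<Sum>j\<in>UNIV. \<bar>real_of_int (k $ j)\<bar>) < 2 ^ i"
      using real_arch_pow[of 2] by auto
    have "\<bar>real_of_int (k $ j)\<bar> \<le> 2 ^ i * q" for j
    proof -
      have "\<bar>real_of_int (k $ j)\<bar> \<le> (\<Sum>j\<in>UNIV. \<bar>real_of_int (k $ j)\<bar>)"
        by (rule member_le_sum) auto
      also have "\<dots> \<le> 2 ^ i * 1" using i by simp
      also have "\<dots> \<le> 2 ^ i * q" using q by (intro mult_left_mono) auto
      finally show ?thesis .
    qed
    thus ?thesis unfolding idx_def by (intro LeastI[of "\<lambda>i. \<forall>j. \<bar>real_of_int (k $ j)\<bar> \<le> 2 ^ i * q" i]) auto
  qed
  have idx': "\<exists>j. 2 ^ idx k * q < 2 * \<bar>real_of_int (k $ j)\<bar>" if pos: "0 < idx k" for k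
  proof -
    obtain i where i: "idx k = Suc i" using gr0_implies_Suc[OF pos] by blast
    have "\<not> (\<forall>j. \<bar>real_of_int (k $ j)\<bar> \<le> 2 ^ i * q)"
      using not_less_Least[of i "\<lambda>i. \<forall>j. \<bar>real_of_int (k $ j)\<bar> \<le> 2 ^ i * q"] i by (simp add: idx_def)
    thus ?thesis by (auto simp: i not_le)
  qed
  have blk: "(\<Sum>k\<in>{k\<in>F. idx k = i}. a k powr p) \<le> (3 ^ CARD('m) + D) * q powr w * \<rho> ^ i" for i
  proof -
    define H where "H = {k\<in>F. idx k = i}"
    define N where "N = 2 ^ i * q"
    define \<sigma> where "\<sigma> = 2 powr (- s * real i)"
    \<comment> \<open>Up to constants, \<open>\<tau>\<close> is the root mean square size of the
      coefficients on a full block. It makes both terms of the threshold inequality contribute the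
      same amount, as \<open>t1\<close> and \<open>t2\<close> show.\<close>
    define \<tau> where "\<tau> = N powr (- real CARD('m) / 2) * \<sigma>"
    have N: "1 \<le> N" unfolding N_def using q mult_mono[of 1 "2 ^ i" 1 q] by simp
    have pos: "0 < \<sigma>" "0 < \<tau>" using N by (auto simp: \<sigma>_def \<tau>_def)
    have H: "finite H" using F by (simp add: H_def)
    have "H \<subseteq> {k. \<forall>j. \<bar>of_int (k $ j)\<bar> \<le> N}" using idx by (auto simp: H_def N_def)
    hence "real (card H) \<le> real (card {k :: int^'m. \<forall>j. \<bar>of_int (k $ j)\<bar> \<le> N})"
      by (intro of_nat_mono card_mono card_int_cube(1)[OF N])
    also have "\<dots> \<le> (3 * N) ^ CARD('m)" by (rule card_int_cube(2)[OF N])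
    also have "\<dots> = 3 ^ CARD('m) * N powr real CARD('m)"
      using N by (simp add: power_mult_distrib powr_realpow)
    finally have card: "real (card H) \<le> 3 ^ CARD('m) * N powr real CARD('m)" .
    have sq: "(\<Sum>k\<in>H. (a k)\<^sup>2) \<le> D * \<sigma>\<^sup>2"
      unfolding \<sigma>_def using H idx idx' by (intro block) (auto simp: H_def)
    have Nw: "N powr w * \<sigma> powr p = q powr w * \<rho> ^ i"
    proof -
      have "N powr w = 2 powr (real i * w) * q powr w"
        using q by (simp add: N_def powr_mult powr_powr flip: powr_realpow)
      moreover have "\<rho> ^ i = 2 powr (real i * w) * \<sigma> powr p"
        using \<rho> by (simp add: \<sigma>_def \<rho>_def powr_powr powr_add[symmetric] algebra_simps flip: powr_realpow)
      ultimately show ?thesis by simp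
    qed
    have t1: "N powr real CARD('m) * \<tau> powr p = N powr w * \<sigma> powr p"
      using N pos by (simp add: \<tau>_def powr_mult powr_powr w_def algebra_simps flip: powr_add)
    have t2: "\<tau> powr (p - 2) * \<sigma>\<^sup>2 = N powr w * \<sigma> powr p"
    proof -
      have "(- real CARD('m) / 2) * (p - 2) = w" by (simp add: w_def field_simps)
      hence "\<tau> powr (p - 2) = N powr w * \<sigma> powr (p - 2)"
        using N pos by (simp add: \<tau>_def powr_mult powr_powr)
      moreover have "\<sigma> powr (p - 2) * \<sigma>\<^sup>2 = \<sigma> powr p" using pos by (simp add: powr_diff)
      ultimately show ?thesis by simp
    qed
    have "(\<Sum>k\<in>H. a k powr p) \<le> (\<Sum>k\<in>H. \<tau> powr p + \<tau> powr (p - 2) * (a k)\<^sup>2)"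
      using a pos p by (intro sum_mono powr_le_threshold) auto
    also have "\<dots> = real (card H) * \<tau> powr p + \<tau> powr (p - 2) * (\<Sum>k\<in>H. (a k)\<^sup>2)"
      by (simp add: sum.distrib sum_distrib_left)
    also have "\<dots> \<le> (3 ^ CARD('m) * N powr real CARD('m)) * \<tau> powr p + \<tau> powr (p - 2) * (D * \<sigma>\<^sup>2)"
      using card sq by (intro add_mono mult_right_mono mult_left_mono) auto
    also have "\<dots> = 3 ^ CARD('m) * (N powr real CARD('m) * \<tau> powr p) + D * (\<tau> powr (p - 2) * \<sigma>\<^sup>2)"
      by (simp only: mult_ac)
    also have "\<dots> = (3 ^ CARD('m) + D) * q powr w * \<rho> ^ i"
      unfolding t1 t2 Nw by (simp only: distrib_right mult.assoc)
    finally show ?thesis by (simp only: H_def)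
  qed
  have "(\<Sum>k\<in>F. a k powr p) = (\<Sum>i\<in>idx ` F. \<Sum>k\<in>{k\<in>F. idx k = i}. a k powr p)"
    using F by (intro sum.group[symmetric]) auto
  also have "\<dots> \<le> (\<Sum>i\<in>idx ` F. (3 ^ CARD('m) + D) * q powr w * \<rho> ^ i)"
    by (intro sum_mono blk)
  also have "\<dots> = (3 ^ CARD('m) + D) * q powr w * (\<Sum>i\<in>idx ` F. \<rho> ^ i)"
    by (simp only: sum_distrib_left)
  \<comment> \<open>The finite sum over occupied blocks is dominated by the full geometric series,
    independently of \<open>F\<close>.\<close>
  also have "\<dots> \<le> (3 ^ CARD('m) + D) * q powr w * (1 / (1 - \<rho>))"
  proof (intro mult_left_mono)
    have "(\<Sum>i\<in>idx ` F. \<rho> ^ i) \<le> suminf (\<lambda>i. \<rho> ^ i)"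
      using \<rho> F by (intro sum_le_suminf summable_geometric) auto
    thus "(\<Sum>i\<in>idx ` F. \<rho> ^ i) \<le> 1 / (1 - \<rho>)" using \<rho> by (simp add: suminf_geometric)
  qed (use D in auto)
  finally show ?thesis by (simp add: \<rho>_def)
qed

section \<open>The norm estimate for the exponential of a large phase\<close>

theorem theorem3:
  fixes \<phi> :: "real^'m \<Rightarrow> real" and p \<alpha> :: real and \<nu> :: nat
  assumes "1 \<le> p" "p < 2" "0 \<le> \<alpha>" "\<alpha> \<le> 1"
    and "C_nu_alpha \<nu> \<alpha> \<phi>"
    and "real \<nu> + \<alpha> \<ge> 1"
    and "real \<nu> + \<alpha> > real CARD('m) * (1/p - 1/2)"
  shows "\<exists>C \<Lambda>. \<forall>lam::real. \<bar>lam\<bar> \<ge> \<Lambda> \<longrightarrow>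
           in_Ap p (\<lambda>t. exp (\<i> * complex_of_real (lam * \<phi> t))) \<and>
           Ap_norm p (\<lambda>t. exp (\<i> * complex_of_real (lam * \<phi> t)))
             \<le> C * \<bar>lam\<bar> powr (real CARD('m) * (1/p - 1/2))"
proof -
  obtain n \<beta> where s: "real n + \<beta> = real \<nu> + \<alpha>"
    and reg: "\<And>j. \<exists>d C. axis_regular j d n \<beta> C \<and> d 0 = \<phi>"
    using C_nu_alpha_axis_regular[OF assms(5,3,4,6)] by blast
  define s where "s = real n + \<beta>"
  define e where "e lam t = exp (\<i> * complex_of_real (lam * \<phi> t))" for lam t
  have "\<exists>K. \<forall>lam h x. 1 \<le> \<bar>lam\<bar> \<longrightarrow> 0 < h \<longrightarrow>
      norm ((axis_difference j h ^^ Suc n) (e lam) x) \<le> K * (\<bar>lam\<bar> * h) powr s" for j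
    using reg[of j] axis_regular.exp_iterated_difference_bound unfolding e_def s_def by blast
  then obtain K where K: "\<And>j lam h x. 1 \<le> \<bar>lam\<bar> \<Longrightarrow> 0 < h \<Longrightarrow>
      norm ((axis_difference j h ^^ Suc n) (e lam) x) \<le> K j * (\<bar>lam\<bar> * h) powr s"
    by metis
  \<comment> \<open>One constant for all axes, as the block estimate requires the same bound in
    every direction.\<close>
  define K' where "K' = (\<Sum>j\<in>UNIV. \<bar>K j\<bar>)"
  have K': "K j \<le> K'" for j
    using member_le_sum[of j UNIV "\<lambda>j. \<bar>K j\<bar>"] by (simp add: K'_def)
  have "continuous_on UNIV \<phi>"
    using reg axis_regular.axis_lipschitz by (intro continuous_on_of_axis_lipschitz) blast
  hence cont: "continuous_on UNIV (e lam)" for lam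
    unfolding e_def by (intro continuous_intros)
  have per: "torus_periodic (e lam)" for lam
    using assms(5) by (simp add: C_nu_alpha_def torus_periodic_def e_def)
  \<comment> \<open>The 1 serves block 0, where only Bessel's inequality is used; the other entry is
    the constant of all later blocks.\<close>
  define D where "D = max 1 (real CARD('m) * (K' * pi powr s)\<^sup>2)"
  \<comment> \<open>This is p times the exponent of the theorem, so taking the p-th root at the end
    restores that exponent.\<close>
  define w where "w = real CARD('m) * (1 - p / 2)"
  define C where "C = (3 ^ CARD('m) + D) / (1 - 2 powr (w - s * p))"
  have D: "0 \<le> D" by (simp add: D_def)
  have ws: "w < s * p"
  proof -
    have "w = real CARD('m) * (1/p - 1/2) * p" using assms(1) by (simp add: w_def field_simps)
    also have "\<dots> < s * p" using assms(1,7) s by (intro mult_strict_right_mono) (auto simp: s_def)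
    finally show ?thesis .
  qed
  have "2 powr (w - s * p) < (2::real) powr 0" using ws by (intro powr_less_mono) auto
  hence C: "0 \<le> C" using D by (simp add: C_def)
  have bound: "(\<Sum>k\<in>F. norm (fourier_coeff (e lam) k) powr p) \<le> C * \<bar>lam\<bar> powr w"
    if lam: "1 \<le> \<bar>lam\<bar>" and F: "finite F" for lam F
    unfolding C_def w_def
  proof (rule sum_powr_dyadic_blocks_le[where q = "\<bar>lam\<bar>" and s = s])
    fix i :: nat and F :: "(int^'m) set"
    assume F: "finite F" and le: "\<And>k. k \<in> F \<Longrightarrow> \<forall>j. \<bar>of_int (k $ j)\<bar> \<le> 2 ^ i * \<bar>lam\<bar>"
      and gt: "\<And>k. k \<in> F \<Longrightarrow> 0 < i \<Longrightarrow> \<exists>j. 2 ^ i * \<bar>lam\<bar> < 2 * \<bar>of_int (k $ j)\<bar>"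
    show "(\<Sum>k\<in>F. (norm (fourier_coeff (e lam) k))\<^sup>2) \<le> D * (2 powr (- s * real i))\<^sup>2"
    proof (cases "i = 0")
      case True
      \<comment> \<open>Block 0 offers no large coordinate, but \<open>e lam\<close> has modulus
        1.\<close>
      have "(\<Sum>k\<in>F. (norm (fourier_coeff (e lam) k))\<^sup>2) \<le> 1\<^sup>2"
        by (intro bessel_fourier_coeff cont F) (simp add: e_def)
      thus ?thesis using True by (simp add: D_def)
    next
      case False
      define N where "N = 2 ^ i * \<bar>lam\<bar>"
      have N: "1 \<le> N" unfolding N_def using lam mult_mono[of 1 "2 ^ i" 1 "\<bar>lam\<bar>"] by simp
      \<comment> \<open>Because the radii are multiples of |lam|, the parameter cancels and the
        decay over the blocks is uniform in \<open>lam\<close>.\<close>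
      have "(\<bar>lam\<bar> * (pi / N)) powr s = pi powr s * 2 powr (- s * real i)"
      proof -
        have "\<bar>lam\<bar> * (pi / N) = pi * 2 powr (- real i)"
          using lam by (simp add: N_def powr_minus powr_realpow field_simps)
        thus ?thesis by (simp add: powr_mult powr_powr mult.commute)
      qed
      moreover have "norm ((axis_difference j (pi / N) ^^ Suc n) (e lam) x) \<le> K' * (\<bar>lam\<bar> * (pi / N)) powr s" for j x
        using K[OF lam, of "pi / N" j x] N mult_right_mono[OF K', of "(\<bar>lam\<bar> * (pi / N)) powr s" j] by simp
      ultimately have "(\<Sum>k\<in>F. (norm (fourier_coeff (e lam) k))\<^sup>2) \<le> real CARD('m) * (K' * (pi powr s * 2 powr (- s * real i)))\<^sup>2"
        using le gt False unfolding N_def[symmetric]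
        by (intro fourier_coeff_block_bound[where n = "Suc n", OF cont per N F]) auto
      also have "\<dots> = (real CARD('m) * (K' * pi powr s)\<^sup>2) * (2 powr (- s * real i))\<^sup>2"
        by (simp only: power_mult_distrib mult_ac)
      also have "\<dots> \<le> D * (2 powr (- s * real i))\<^sup>2"
        unfolding D_def by (intro mult_right_mono) auto
      finally show ?thesis .
    qed
  qed (use assms lam F ws D in \<open>auto simp: w_def\<close>)
  show ?thesis
  proof (rule exI[of _ "C powr (1/p)"], rule exI[of _ 1], intro allI impI)
    fix lam :: real assume lam: "1 \<le> \<bar>lam\<bar>"
    \<comment> \<open>The bound holds for every finite set of frequencies, which gives membership in
      the space as well as the norm estimate.\<close>
    have sm: "(\<lambda>k. norm (fourier_coeff (e lam) k) powr p) summable_on UNIV"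
      using bound[OF lam] by (intro nonneg_bdd_above_summable_on) (auto simp: bdd_above_def)
    have "(\<Sum>\<^sub>\<infinity>k. norm (fourier_coeff (e lam) k) powr p) \<le> C * \<bar>lam\<bar> powr w"
      using bound[OF lam] by (intro infsum_le_finite_sums sm)
    hence "Ap_norm p (e lam) \<le> (C * \<bar>lam\<bar> powr w) powr (1/p)"
      unfolding Ap_norm_def using assms(1) by (intro powr_mono2 infsum_nonneg) auto
    also have "\<dots> = C powr (1/p) * \<bar>lam\<bar> powr (w / p)"
      using C by (simp add: powr_mult powr_powr)
    also have "w / p = real CARD('m) * (1/p - 1/2)"
      using assms(1) by (simp add: w_def field_simps)
    finally show "in_Ap p (\<lambda>t. exp (\<i> * complex_of_real (lam * \<phi> t))) \<and>
           Ap_norm p (\<lambda>t. exp (\<i> * complex_of_real (lam * \<phi> t)))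
             \<le> C powr (1/p) * \<bar>lam\<bar> powr (real CARD('m) * (1/p - 1/2))"
      using sm unfolding in_Ap_def e_def[abs_def] by simp
  qed
qed

end
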